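(* Let $n \geq 1$ be an integer and let $\lambda = (n_1, \ldots, n_l)$ be a partition of $n$. The lower central series of the partitioned braid group $\mathbf{B}_\lambda$: \begin{itemize} \item stops at $\Gamma_2$ if $n_i \geq 3$ for all $i$, save at most two indices for which $n_i = 1$; \item does not stop in all the other cases, except for $\mathbf{B}_2 \cong \mathbb{Z}$ (that is, $\lambda = (2)$). \end{itemize}
   Context: For a group $G$, $\Gamma_1(G) = G$ and $\Gamma_{i}(G) = [G, \Gamma_{i-1}(G)]$ for $i \geq 2$. The lower central series of $G$ stops if $\Gamma_i(G) = \Gamma_{i+1}(G)$ for some $i \geq 1$; it stops at $\Gamma_k$ if $k$ is the smallest such $i$. Otherwise it does not stop. A partition of $n$ is a tuple $\lambda = (n_1, \ldots, n_l)$ of integers $n_i \geq 1$ with sum $n$. Let $\mathfrak{S}_\lambda = \mathfrak{S}_{n_1} \times \cdots \times \mathfrak{S}_{n_l} \subseteq \mathfrak{S}_n$ be the subgroup preserving each of the consecutive blocks $\{t_{j-1}+1, \ldots, t_j\}$, where $t_j = n_1 + \cdots + n_j$. Let $\mathbf{B}_n$ be the Artin braid group on $n$ strands and $\pi : \mathbf{B}_n \to \mathfrak{S}_n$ the canonical projection. The $\lambda$-partitioned braid group is $\mathbf{B}_\lambda := \pi^{-1}(\mathfrak{S}_\lambda) \subseteq \mathbf{B}_n$.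
   Formalization: For the partition λ = (1) the group B_1 is trivial, so its lower central series stops at Γ_1 rather than at Γ_2; the formal statement asserts this in that one case and the claim as given in all others. *)

theory Defs
  imports "HOL-Algebra.Sym_Groups" "HOL-Algebra.Elementary_Groups"
begin

section \<open>Groups given by generators and relations\<close>

text \<open>A letter \<open>(x, True)\<close> stands for the generator \<open>x\<close>, and \<open>(x, False)\<close> for its formal inverse.
  A relation \<open>r = s\<close> is encoded as the pair \<open>(r, s)\<close> of words.\<close>

type_synonym 'a letter = "'a \<times> bool"

definition words :: "'a set \<Rightarrow> 'a letter list set" where
  "words S = lists (S \<times> UNIV)"

inductive pres_eq :: "'a set \<Rightarrow> ('a letter list \<times> 'a letter list) set \<Rightarrow>
    'a letter list \<Rightarrow> 'a letter list \<Rightarrow> bool" for S R where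
  refl: "w \<in> words S \<Longrightarrow> pres_eq S R w w"
| sym: "pres_eq S R u v \<Longrightarrow> pres_eq S R v u"
| trans: "pres_eq S R u v \<Longrightarrow> pres_eq S R v w \<Longrightarrow> pres_eq S R u w"
| cancel: "u \<in> words S \<Longrightarrow> v \<in> words S \<Longrightarrow> x \<in> S \<Longrightarrow>
    pres_eq S R (u @ [(x, b), (x, \<not> b)] @ v) (u @ v)"
| rel: "u \<in> words S \<Longrightarrow> v \<in> words S \<Longrightarrow> (r, s) \<in> R \<Longrightarrow> r \<in> words S \<Longrightarrow> s \<in> words S \<Longrightarrow>
    pres_eq S R (u @ r @ v) (u @ s @ v)"

definition pres_rel :: "'a set \<Rightarrow> ('a letter list \<times> 'a letter list) set \<Rightarrow> 'a letter list rel" where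
  "pres_rel S R = {(u, v). pres_eq S R u v}"

definition presented_group :: "'a set \<Rightarrow> ('a letter list \<times> 'a letter list) set \<Rightarrow>
    'a letter list set monoid" where
  "presented_group S R =
     \<lparr> carrier = words S // pres_rel S R,
       mult = (\<lambda>X Y. pres_rel S R `` {x @ y | x y. x \<in> X \<and> y \<in> Y}),
       one = pres_rel S R `` {[]} \<rparr>"

lemma words_simps [simp]:
  "[] \<in> words S"
  "u @ v \<in> words S \<longleftrightarrow> u \<in> words S \<and> v \<in> words S"
  "a # u \<in> words S \<longleftrightarrow> fst a \<in> S \<and> u \<in> words S"
  by (cases a; auto simp: words_def)+

lemma pres_eq_words: "pres_eq S R u v \<Longrightarrow> u \<in> words S \<and> v \<in> words S"
  by (induction rule: pres_eq.induct) auto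

lemma pres_eq_ctxt:
  assumes "pres_eq S R u v" "p \<in> words S" "q \<in> words S"
  shows "pres_eq S R (p @ u @ q) (p @ v @ q)"
  using assms
proof (induction rule: pres_eq.induct)
  case (refl w)
  then show ?case by (intro pres_eq.refl) simp
next
  case (sym u v)
  then show ?case by (blast intro: pres_eq.sym)
next
  case (trans u v w)
  then show ?case by (blast intro: pres_eq.trans)
next
  case (cancel u v x b)
  then show ?case using pres_eq.cancel[of "p @ u" S "v @ q" x R b] by simp
next
  case (rel u v r s)
  then show ?case using pres_eq.rel[of "p @ u" S "v @ q" r s R] by simp
qed

lemma pres_eq_append:
  assumes "pres_eq S R u u'" "pres_eq S R v v'"
  shows "pres_eq S R (u @ v) (u' @ v')"
  using pres_eq_ctxt[OF assms(1), of "[]" v] pres_eq_ctxt[OF assms(2), of u' "[]"]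
    pres_eq_words[OF assms(1)] pres_eq_words[OF assms(2)]
  by (auto intro: pres_eq.trans)

lemma equiv_pres_rel: "equiv (words S) (pres_rel S R)"
  by (auto intro!: equivI refl_onI symI transI simp: pres_rel_def dest: pres_eq_words
      intro: pres_eq.intros)

lemma pres_class_eq_iff:
  assumes "u \<in> words S" "v \<in> words S"
  shows "pres_rel S R `` {u} = pres_rel S R `` {v} \<longleftrightarrow> pres_eq S R u v"
  using eq_equiv_class_iff[OF equiv_pres_rel assms, of R] by (simp add: pres_rel_def)

lemma presented_group_carrier:
  "X \<in> carrier (presented_group S R) \<longleftrightarrow> (\<exists>w \<in> words S. X = pres_rel S R `` {w})"
  by (auto simp: presented_group_def quotient_def)

lemma presented_group_one: "\<one>\<^bsub>presented_group S R\<^esub> = pres_rel S R `` {[]}"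
  by (simp add: presented_group_def)

lemma presented_group_mult:
  assumes "u \<in> words S" "v \<in> words S"
  shows "pres_rel S R `` {u} \<otimes>\<^bsub>presented_group S R\<^esub> pres_rel S R `` {v} = pres_rel S R `` {u @ v}"
proof -
  have "pres_eq S R (u @ v) w"
    if "pres_eq S R u x" "pres_eq S R v y" "pres_eq S R (x @ y) w" for x y w
    using that pres_eq_append pres_eq.trans by blast
  moreover have "pres_eq S R u u" "pres_eq S R v v"
    using assms by (auto intro: pres_eq.refl)
  ultimately show ?thesis
    by (auto simp: presented_group_def pres_rel_def)
qed

lemma pres_eq_inverse:
  "w \<in> words S \<Longrightarrow> pres_eq S R (rev (map (\<lambda>(x, b). (x, \<not> b)) w) @ w) []"
proof (induction w)
  case Nil
  then show ?case by (auto intro: pres_eq.refl)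
next
  case (Cons a w)
  obtain x b where a: "a = (x, b)" by force
  let ?r = "rev (map (\<lambda>(x, b). (x, \<not> b)) w)"
  have w: "w \<in> words S" "x \<in> S" using Cons.prems a by auto
  have r: "?r \<in> words S" using w by (auto simp: words_def)
  have "pres_eq S R (?r @ [(x, \<not> b), (x, \<not> \<not> b)] @ w) (?r @ w)"
    by (rule pres_eq.cancel) (use r w in auto)
  with Cons.IH[OF w(1)] show ?case by (auto simp: a intro: pres_eq.trans)
qed

lemma group_presented_group: "group (presented_group S R)"
proof (rule groupI)
  fix X assume "X \<in> carrier (presented_group S R)"
  then obtain w where w: "w \<in> words S" "X = pres_rel S R `` {w}"
    by (auto simp: presented_group_carrier)
  let ?r = "rev (map (\<lambda>(x, b). (x, \<not> b)) w)"
  have "?r \<in> words S" using w by (auto simp: words_def)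
  then show "\<exists>Y\<in>carrier (presented_group S R). Y \<otimes>\<^bsub>presented_group S R\<^esub> X = \<one>\<^bsub>presented_group S R\<^esub>"
    using w pres_eq_inverse[OF w(1), of R] unfolding presented_group_carrier
    by (intro bexI[of _ "pres_rel S R `` {?r}"])
       (simp add: presented_group_mult presented_group_one pres_class_eq_iff,
        blast intro: presented_group_carrier[THEN iffD2])
qed (auto simp: presented_group_carrier presented_group_one presented_group_mult;
     metis presented_group_mult words_simps append_assoc append_Nil)+


section \<open>Artin braid groups\<close>

text \<open>Artin's presentation; the letter \<open>(i, True)\<close> is the standard generator that exchanges the
  strands \<open>i\<close> and \<open>i + 1\<close>.\<close>

definition braid_relations :: "nat \<Rightarrow> (nat letter list \<times> nat letter list) set" where
  "braid_relations n =
     {([(i, True), (j, True)], [(j, True), (i, True)]) | i j. 1 \<le> i \<and> i + 2 \<le> j \<and> j < n} \<union>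
     {([(i, True), (i + 1, True), (i, True)], [(i + 1, True), (i, True), (i + 1, True)])
       | i. 1 \<le> i \<and> i + 1 < n}"

definition braid_group :: "nat \<Rightarrow> nat letter list set monoid" where
  "braid_group n = presented_group {1..<n} (braid_relations n)"

definition word_perm :: "nat letter list \<Rightarrow> nat \<Rightarrow> nat" where
  "word_perm w = foldr (\<lambda>(i, b) p. transpose i (i + 1) \<circ> p) w id"

text \<open>All words in a class have the same permutation, so the image below is a singleton.\<close>

definition braid_perm :: "nat letter list set \<Rightarrow> nat \<Rightarrow> nat" where
  "braid_perm X = the_elem (word_perm ` X)"

lemma word_perm_simps [simp]:
  "word_perm [] = id"
  "word_perm ((i, b) # w) = transpose i (i + 1) \<circ> word_perm w"
  by (simp_all add: word_perm_def)

lemma word_perm_append: "word_perm (u @ v) = word_perm u \<circ> word_perm v"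
  by (induction u) auto

lemma word_perm_permutes: "w \<in> words {1..<n} \<Longrightarrow> word_perm w permutes {1..n}"
proof (induction w)
  case Nil
  show ?case by (simp only: word_perm_simps permutes_id)
next
  case (Cons a w)
  then obtain i b where a: "a = (i, b)" "i \<in> {1..<n}" "w \<in> words {1..<n}" by (cases a) auto
  then have "transpose i (i + 1) permutes {1..n}" by (intro permutes_swap_id) auto
  with Cons.IH[OF a(3)] show ?case unfolding a(1) word_perm_simps by (rule permutes_compose)
qed

lemma word_perm_cong:
  "pres_eq {1..<n} (braid_relations n) u v \<Longrightarrow> word_perm u = word_perm v"
proof (induction rule: pres_eq.induct)
  case (rel u v r s)
  have "word_perm r = word_perm s"
    using rel(3) by (auto simp: braid_relations_def transpose_def fun_eq_iff)
  then show ?case by (simp add: word_perm_append)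
qed (auto simp: word_perm_append fun_eq_iff)

lemma braid_perm_class:
  assumes "w \<in> words {1..<n}"
  shows "braid_perm (pres_rel {1..<n} (braid_relations n) `` {w}) = word_perm w"
proof -
  have "word_perm ` (pres_rel {1..<n} (braid_relations n) `` {w}) = {word_perm w}"
    using assms word_perm_cong[of n w]
    by (auto simp: pres_rel_def image_iff simp del: One_nat_def intro!: bexI[of _ w]
        intro: pres_eq.refl)
  then show ?thesis by (simp add: braid_perm_def)
qed

lemma group_braid_group: "group (braid_group n)"
  by (simp add: braid_group_def group_presented_group)

lemma braid_perm_hom: "braid_perm \<in> hom (braid_group n) (sym_group n)"
  by (auto intro!: homI simp: braid_group_def presented_group_carrier presented_group_mult
      braid_perm_class word_perm_append word_perm_permutes sym_group_def simp del: One_nat_def)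


section \<open>Partitioned braid groups\<close>

definition partition_of :: "nat \<Rightarrow> nat list \<Rightarrow> bool" where
  "partition_of n lam \<longleftrightarrow> (\<forall>k \<in> set lam. k \<ge> 1) \<and> sum_list lam = n"

text \<open>The blocks are indexed by \<open>j < length lam\<close>, counting from 0.\<close>

definition partition_block :: "nat list \<Rightarrow> nat \<Rightarrow> nat set" where
  "partition_block lam j = {sum_list (take j lam) + 1 .. sum_list (take (j + 1) lam)}"

definition young_subgroup :: "nat list \<Rightarrow> (nat \<Rightarrow> nat) set" where
  "young_subgroup lam =
     {p \<in> carrier (sym_group (sum_list lam)).
        \<forall>j < length lam. p ` partition_block lam j = partition_block lam j}"

definition partitioned_braid_group :: "nat list \<Rightarrow> nat letter list set monoid" where
  "partitioned_braid_group lam =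
     (braid_group (sum_list lam))
       \<lparr> carrier := {X \<in> carrier (braid_group (sum_list lam)). braid_perm X \<in> young_subgroup lam} \<rparr>"

lemma subgroup_young_subgroup: "subgroup (young_subgroup lam) (sym_group (sum_list lam))"
proof -
  interpret group "sym_group (sum_list lam)" by (rule sym_group_is_group)
  show ?thesis
  proof (rule subgroupI)
    show "young_subgroup lam \<noteq> {}"
      by (auto simp: young_subgroup_def sym_group_def intro!: exI[of _ id] permutes_id)
  next
    fix p assume p: "p \<in> young_subgroup lam"
    then have perm: "p permutes {1..sum_list lam}"
      by (simp add: young_subgroup_def sym_group_def)
    have "inv' p ` B = B" if "p ` B = B" for B
      using that perm by (metis image_inv_f_f permutes_inj)
    with p perm show "inv\<^bsub>sym_group (sum_list lam)\<^esub> p \<in> young_subgroup lam"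
      by (auto simp: young_subgroup_def sym_group_inv_equality sym_group_carrier permutes_inv)
  next
    fix p q assume "p \<in> young_subgroup lam" "q \<in> young_subgroup lam"
    moreover have "(p \<circ> q) ` B = B" if "p ` B = B" "q ` B = B" for B
      using that by (metis image_comp)
    ultimately show "p \<otimes>\<^bsub>sym_group (sum_list lam)\<^esub> q \<in> young_subgroup lam"
      by (simp add: young_subgroup_def sym_group_def permutes_compose del: One_nat_def o_apply)
  qed (auto simp: young_subgroup_def)
qed

lemma group_partitioned_braid_group: "group (partitioned_braid_group lam)"
proof -
  let ?n = "sum_list lam"
  interpret group_hom "braid_group ?n" "sym_group ?n" braid_perm
    by (simp add: group_hom_def group_hom_axioms_def group_braid_group sym_group_is_group
        braid_perm_hom)
  have "inv\<^bsub>sym_group ?n\<^esub> p \<in> young_subgroup lam" if "p \<in> young_subgroup lam" for p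
    using subgroup_young_subgroup that by (rule subgroup.m_inv_closed)
  then have "subgroup {X \<in> carrier (braid_group ?n). braid_perm X \<in> young_subgroup lam} (braid_group ?n)"
    using subgroup_young_subgroup[of lam]
    by (intro G.subgroupI)
       (auto simp del: sym_group_inv_equality intro: subgroup.m_closed subgroup.one_closed
         intro!: exI[of _ "\<one>\<^bsub>braid_group ?n\<^esub>"])
  then show ?thesis
    unfolding partitioned_braid_group_def by (rule G.subgroup_imp_group)
qed


section \<open>The lower central series\<close>

definition commutator_subgroup :: "('a, 'b) monoid_scheme \<Rightarrow> 'a set \<Rightarrow> 'a set \<Rightarrow> 'a set" where
  "commutator_subgroup G H K =
     generate G {h \<otimes>\<^bsub>G\<^esub> k \<otimes>\<^bsub>G\<^esub> inv\<^bsub>G\<^esub> h \<otimes>\<^bsub>G\<^esub> inv\<^bsub>G\<^esub> k | h k. h \<in> H \<and> k \<in> K}"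

text \<open>The series is indexed from 1; the value at 0 is a dummy that is excluded everywhere below.\<close>

fun lower_central :: "('a, 'b) monoid_scheme \<Rightarrow> nat \<Rightarrow> 'a set" where
  "lower_central G 0 = carrier G"
| "lower_central G (Suc 0) = carrier G"
| "lower_central G (Suc (Suc i)) = commutator_subgroup G (carrier G) (lower_central G (Suc i))"

definition lcs_stops :: "('a, 'b) monoid_scheme \<Rightarrow> bool" where
  "lcs_stops G \<longleftrightarrow> (\<exists>i \<ge> 1. lower_central G i = lower_central G (i + 1))"

definition lcs_stops_at :: "('a, 'b) monoid_scheme \<Rightarrow> nat \<Rightarrow> bool" where
  "lcs_stops_at G k \<longleftrightarrow>
     k \<ge> 1 \<and> lower_central G k = lower_central G (k + 1) \<and>
     (\<forall>i. 1 \<le> i \<and> i < k \<longrightarrow> lower_central G i \<noteq> lower_central G (i + 1))"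

text \<open>All \<open>n\<^sub>i \<ge> 3\<close>, save at most two indices for which \<open>n\<^sub>i = 1\<close>.\<close>

definition blocks_large_save_two :: "nat list \<Rightarrow> bool" where
  "blocks_large_save_two lam \<longleftrightarrow>
     (\<forall>i < length lam. lam ! i \<ge> 3 \<or> lam ! i = 1) \<and>
     card {i. i < length lam \<and> lam ! i = 1} \<le> 2"

end

theory Submission
  imports Defs
begin

text \<open>
  Stable case. Modulo \<open>\<Gamma>\<^sub>3\<close> the commutator is bilinear and invariant under conjugating either
  argument, so \<open>\<Gamma>\<^sub>2 = \<Gamma>\<^sub>3\<close> as soon as generators have conjugates that commute modulo
  \<open>\<Gamma>\<^sub>3\<close>. The partitioned braid group is generated by the conjugates in the whole braid group of
  half twists of two strands of one block and of full twists of two strands of different blocks, and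
  two such twists with the same pair of blocks are conjugate in it. If the blocks are large enough,
  disjoint twists represent both classes; if a block of size 1 is shared, the relation between the
  three full twists of three strands reduces the claim to two twists sharing a larger block.

  Unstable case. A block of size 2 next to another block, or three blocks of size 1, yield a
  homomorphism to the infinite dihedral group whose image contains a reflection and a nontrivial
  translation, and this forbids that the lower central series stops.
\<close>

section \<open>Commutators modulo the third term of the lower central series\<close>

text \<open>Artin's generators need not preserve the blocks, and no presentation of the partitioned
  group is derived. The stable case only needs generators of it: in place of a Reidemeister-Schreier
  process, positive Artin generators sort the block indices of an arbitrary braid, and twists
  account for the ambiguity. The unstable case needs homomorphisms out of it: each letter gets a
  value that depends on the current colouring of the positions, so that only Artin's relations have
  to be checked, and words of the partitioned group restore the colouring. The delicate point of the
  stable case is that modulo \<open>\<Gamma>\<^sub>3\<close> only conjugation inside the partitioned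
  group is free. A braid conjugating one twist to another must be found with a prescribed
  permutation, which leads to lifting permutations through centralisers of generators. Twists on
  disjoint strands need not commute, but suitable conjugates of them do. Convention:
  \<open>perm b k\<close> is the starting position of the strand that \<open>b\<close> brings to
  position \<open>k\<close>, so right multiplication by \<open>sig i\<close> exchanges the strands
  at the final positions \<open>i\<close> and \<open>i + 1\<close>.\<close>

context group begin

lemma mult_inv_cancel:
  assumes "x \<in> carrier G" "y \<in> carrier G"
  shows "inv x \<otimes> (x \<otimes> y) = y" "x \<otimes> (inv x \<otimes> y) = y"
  using assms by (simp_all add: m_assoc[symmetric])

lemma commutator_subgroup_normal:
  assumes "N \<lhd> G"
  shows "commutator_subgroup G (carrier G) N \<lhd> G"
proof -
  interpret N: normal N G by fact
  have sub: "N \<subseteq> carrier G" by (rule N.subset)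
  show ?thesis
    unfolding commutator_subgroup_def
  proof (rule normal_generateI)
    fix h g
    assume "h \<in> {h \<otimes> k \<otimes> inv h \<otimes> inv k |h k. h \<in> carrier G \<and> k \<in> N}" and g: "g \<in> carrier G"
    then obtain x k where xk: "x \<in> carrier G" "k \<in> N" and h: "h = x \<otimes> k \<otimes> inv x \<otimes> inv k" by auto
    have k: "k \<in> carrier G" using xk sub by auto
    have "g \<otimes> h \<otimes> inv g = (g \<otimes> x \<otimes> inv g) \<otimes> (g \<otimes> k \<otimes> inv g) \<otimes> inv (g \<otimes> x \<otimes> inv g) \<otimes> inv (g \<otimes> k \<otimes> inv g)"
      unfolding h using g xk k by (simp add: inv_mult_group m_assoc mult_inv_cancel)
    moreover have "g \<otimes> k \<otimes> inv g \<in> N" using N.inv_op_closed2 g xk by simp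
    ultimately show "g \<otimes> h \<otimes> inv g \<in> {h \<otimes> k \<otimes> inv h \<otimes> inv k |h k. h \<in> carrier G \<and> k \<in> N}"
      using g xk by blast
  qed (use sub in auto)
qed

lemma commutator_subgroup_subset:
  assumes "N \<lhd> G"
  shows "commutator_subgroup G (carrier G) N \<subseteq> N"
proof -
  interpret N: normal N G by fact
  have "h \<otimes> k \<otimes> inv h \<otimes> inv k \<in> N" if "h \<in> carrier G" "k \<in> N" for h k
    using N.inv_op_closed2 that by blast
  then show ?thesis
    unfolding commutator_subgroup_def by (intro generate_subgroup_incl N.subgroup_axioms) auto
qed

lemma lower_central_Suc:
  "1 \<le> i \<Longrightarrow> lower_central G (Suc i) = commutator_subgroup G (carrier G) (lower_central G i)"
  by (cases i) auto

lemma lower_central_normal: "lower_central G i \<lhd> G"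
proof -
  have carrier: "carrier G \<lhd> G" by (simp add: normal_inv_iff subgroup_self)
  show ?thesis
  proof (induction i)
    case (Suc i)
    then show ?case
      using carrier commutator_subgroup_normal lower_central_Suc[of i]
      by (cases i) (simp_all del: lower_central.simps(3))
  qed (simp add: carrier)
qed

lemma lower_central_Suc_subset: "1 \<le> i \<Longrightarrow> lower_central G (Suc i) \<subseteq> lower_central G i"
  by (simp add: lower_central_Suc commutator_subgroup_subset lower_central_normal)

lemma commutator_in_lower_central:
  "1 \<le> i \<Longrightarrow> x \<in> carrier G \<Longrightarrow> y \<in> lower_central G i \<Longrightarrow>
     x \<otimes> y \<otimes> inv x \<otimes> inv y \<in> lower_central G (Suc i)"
  by (auto simp: lower_central_Suc commutator_subgroup_def intro: generate.incl)

lemma lower_central_stable: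
  assumes "1 \<le> i" "lower_central G i = lower_central G (i + 1)"
  shows "lower_central G (i + k) = lower_central G i"
proof (induction k)
  case (Suc k)
  have "lower_central G (i + Suc k) = commutator_subgroup G (carrier G) (lower_central G (i + k))"
    using assms(1) lower_central_Suc[of "i + k"] by (metis add_Suc_right le_add1 le_trans)
  also have "\<dots> = lower_central G (i + 1)"
    using assms(1) lower_central_Suc[of i] by (metis Suc.IH Suc_eq_plus1)
  finally show ?case using assms(2) by metis
qed simp

lemma commuting_commutator:
  "x \<otimes> y = y \<otimes> x \<Longrightarrow> x \<in> carrier G \<Longrightarrow> y \<in> carrier G \<Longrightarrow> x \<otimes> y \<otimes> inv x \<otimes> inv y = \<one>"
  by (simp add: m_assoc)

lemma comm_group_lower_central:
  assumes comm: "\<And>x y. x \<in> carrier G \<Longrightarrow> y \<in> carrier G \<Longrightarrow> x \<otimes> y = y \<otimes> x" and "2 \<le> i"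
  shows "lower_central G i = {\<one>}"
proof -
  obtain j where i: "i = Suc j" "1 \<le> j" using assms(2) by (cases i) auto
  interpret N: normal "lower_central G j" G by (rule lower_central_normal)
  have "{h \<otimes> k \<otimes> inv h \<otimes> inv k |h k. h \<in> carrier G \<and> k \<in> lower_central G j} \<subseteq> {\<one>}"
  proof clarify
    fix h k assume "h \<in> carrier G" "k \<in> lower_central G j"
    then show "h \<otimes> k \<otimes> inv h \<otimes> inv k = \<one>"
      by (intro commuting_commutator comm) (auto dest: N.mem_carrier)
  qed
  then have "lower_central G i \<subseteq> {\<one>}"
    unfolding i(1) lower_central_Suc[OF i(2)] commutator_subgroup_def
    by (intro generate_subgroup_incl triv_subgroup)
  moreover have "\<one> \<in> lower_central G i"
    using lower_central_normal[of i] by (simp add: normal_def subgroup.one_closed)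
  ultimately show ?thesis by auto
qed

lemma centralizer_subgroup:
  assumes "x \<in> carrier G"
  shows "subgroup {y \<in> carrier G. x \<otimes> y = y \<otimes> x} G"
proof (rule subgroupI)
  fix y assume y: "y \<in> {y \<in> carrier G. x \<otimes> y = y \<otimes> x}"
  then have "inv y \<otimes> (x \<otimes> y) \<otimes> inv y = inv y \<otimes> (y \<otimes> x) \<otimes> inv y" by simp
  moreover have "y \<in> carrier G" using y by simp
  then have "inv y \<otimes> (x \<otimes> y) \<otimes> inv y = inv y \<otimes> x" "inv y \<otimes> (y \<otimes> x) \<otimes> inv y = x \<otimes> inv y"
    using assms by (simp_all add: m_assoc mult_inv_cancel)
  ultimately have "inv y \<otimes> x = x \<otimes> inv y" by simp
  then show "inv y \<in> {y \<in> carrier G. x \<otimes> y = y \<otimes> x}" using y by simp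
next
  fix y z assume yz: "y \<in> {y \<in> carrier G. x \<otimes> y = y \<otimes> x}" "z \<in> {y \<in> carrier G. x \<otimes> y = y \<otimes> x}"
  then have "x \<otimes> (y \<otimes> z) = (y \<otimes> x) \<otimes> z" using assms by (simp add: m_assoc[symmetric])
  also have "\<dots> = y \<otimes> z \<otimes> x" using yz assms by (simp add: m_assoc)
  finally show "y \<otimes> z \<in> {y \<in> carrier G. x \<otimes> y = y \<otimes> x}" using yz by simp
qed (use assms in auto)

end

context group_hom begin

lemma hom_commutator_eq_one_iff:
  assumes "x \<in> carrier G" "y \<in> carrier G"
  shows "h (x \<otimes> y \<otimes> inv x \<otimes> inv y) = \<one>\<^bsub>H\<^esub> \<longleftrightarrow> h x \<otimes>\<^bsub>H\<^esub> h y = h y \<otimes>\<^bsub>H\<^esub> h x"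
proof -
  have "h (x \<otimes> y \<otimes> inv x \<otimes> inv y) = (h x \<otimes>\<^bsub>H\<^esub> h y) \<otimes>\<^bsub>H\<^esub> inv\<^bsub>H\<^esub> (h y \<otimes>\<^bsub>H\<^esub> h x)"
    using assms by (simp add: H.inv_mult_group H.m_assoc)
  then show ?thesis
    using assms by (metis H.inv_closed H.inv_equality H.inv_inv H.m_closed H.r_inv hom_closed)
qed

text \<open>It is the preimage under \<open>h\<close> of the centraliser of \<open>h x\<close>. For
  the projection to the quotient by \<open>\<Gamma>\<^sub>3\<close> this replaces the bilinearity of
  the commutator.\<close>

lemma commuting_image_subgroup:
  assumes "x \<in> carrier G"
  shows "subgroup {y \<in> carrier G. h x \<otimes>\<^bsub>H\<^esub> h y = h y \<otimes>\<^bsub>H\<^esub> h x} G"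
proof -
  let ?C = "{y \<in> carrier H. h x \<otimes>\<^bsub>H\<^esub> y = y \<otimes>\<^bsub>H\<^esub> h x}"
  have C: "subgroup ?C H" using assms by (intro H.centralizer_subgroup) auto
  have "subgroup {y \<in> carrier G. h y \<in> ?C} G"
  proof (rule G.subgroupI)
    show "{y \<in> carrier G. h y \<in> ?C} \<noteq> {}"
      using subgroup.one_closed[OF C] by (auto intro!: exI[of _ \<one>])
  next
    fix a b assume "a \<in> {y \<in> carrier G. h y \<in> ?C}" "b \<in> {y \<in> carrier G. h y \<in> ?C}"
    then show "a \<otimes> b \<in> {y \<in> carrier G. h y \<in> ?C}"
      using subgroup.m_closed[OF C, of "h a" "h b"] by simp
  next
    fix a assume "a \<in> {y \<in> carrier G. h y \<in> ?C}"
    then show "inv a \<in> {y \<in> carrier G. h y \<in> ?C}"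
      using subgroup.m_inv_closed[OF C, of "h a"] by simp
  qed auto
  also have "{y \<in> carrier G. h y \<in> ?C} = {y \<in> carrier G. h x \<otimes>\<^bsub>H\<^esub> h y = h y \<otimes>\<^bsub>H\<^esub> h x}"
    by auto
  finally show ?thesis .
qed

end

context group begin

definition commute_mod :: "'a \<Rightarrow> 'a \<Rightarrow> bool" where
  "commute_mod x y \<longleftrightarrow> x \<otimes> y \<otimes> inv x \<otimes> inv y \<in> lower_central G 3"

text \<open>In the quotient by \<open>\<Gamma>\<^sub>3\<close> the relation becomes honest
  commutation, so symmetry and closure under products and inverses need no commutator
  identities.\<close>

lemma commute_mod_hom:
  obtains H :: "'a set monoid" and h where "group_hom G H h"
    "\<And>x y. x \<in> carrier G \<Longrightarrow> y \<in> carrier G \<Longrightarrow>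
      commute_mod x y \<longleftrightarrow> h x \<otimes>\<^bsub>H\<^esub> h y = h y \<otimes>\<^bsub>H\<^esub> h x"
proof
  let ?N = "lower_central G 3"
  interpret N: normal ?N G by (rule lower_central_normal)
  show hom: "group_hom G (G Mod ?N) ((#>) ?N)"
    unfolding group_hom_def group_hom_axioms_def
    using N.factorgroup_is_group N.r_coset_hom_Mod is_group by auto
  interpret h: group_hom G "G Mod ?N" "(#>) ?N" by (rule hom)
  show "commute_mod x y \<longleftrightarrow>
      (?N #> x) \<otimes>\<^bsub>G Mod ?N\<^esub> (?N #> y) = (?N #> y) \<otimes>\<^bsub>G Mod ?N\<^esub> (?N #> x)"
    if "x \<in> carrier G" "y \<in> carrier G" for x y
  proof -
    have "z \<in> ?N \<longleftrightarrow> ?N #> z = \<one>\<^bsub>G Mod ?N\<^esub>" if "z \<in> carrier G" for z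
      using coset_join1[OF _ that N.subgroup_axioms] coset_join2[OF that N.subgroup_axioms] by auto
    then have "x \<otimes> y \<otimes> inv x \<otimes> inv y \<in> ?N \<longleftrightarrow> ?N #> (x \<otimes> y \<otimes> inv x \<otimes> inv y) = \<one>\<^bsub>G Mod ?N\<^esub>"
      using that by (meson m_closed inv_closed)
    then show ?thesis unfolding commute_mod_def h.hom_commutator_eq_one_iff[OF that] .
  qed
qed

lemma commute_mod_sym:
  assumes "commute_mod x y" "x \<in> carrier G" "y \<in> carrier G"
  shows "commute_mod y x"
proof -
  obtain H :: "'a set monoid" and h where "group_hom G H h"
    and iff: "\<And>x y. x \<in> carrier G \<Longrightarrow> y \<in> carrier G \<Longrightarrow>
      commute_mod x y \<longleftrightarrow> h x \<otimes>\<^bsub>H\<^esub> h y = h y \<otimes>\<^bsub>H\<^esub> h x"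
    using commute_mod_hom by blast
  show ?thesis using assms(1) iff[OF assms(2,3)] iff[OF assms(3,2)] by simp
qed

lemma commute_mod_commuting:
  assumes "x \<otimes> y = y \<otimes> x" "x \<in> carrier G" "y \<in> carrier G"
  shows "commute_mod x y"
  using commuting_commutator[OF assms] subgroup.one_closed[OF normal_imp_subgroup[OF lower_central_normal[of 3]]]
  by (simp only: commute_mod_def)

lemma commute_mod_subgroup:
  assumes "x \<in> carrier G"
  shows "subgroup {y \<in> carrier G. commute_mod x y} G"
proof -
  obtain H :: "'a set monoid" and h where "group_hom G H h"
    and iff: "\<And>x y. x \<in> carrier G \<Longrightarrow> y \<in> carrier G \<Longrightarrow>
      commute_mod x y \<longleftrightarrow> h x \<otimes>\<^bsub>H\<^esub> h y = h y \<otimes>\<^bsub>H\<^esub> h x"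
    using commute_mod_hom by blast
  then interpret h: group_hom G H h by simp
  have "{y \<in> carrier G. commute_mod x y} = {y \<in> carrier G. h x \<otimes>\<^bsub>H\<^esub> h y = h y \<otimes>\<^bsub>H\<^esub> h x}"
    using iff assms by auto
  then show ?thesis using h.commuting_image_subgroup[OF assms] by simp
qed

text \<open>\<open>\<Gamma>\<^sub>2\<close> is central modulo \<open>\<Gamma>\<^sub>3\<close> by the
  definition of the series.\<close>

lemma commute_mod_commutator:
  assumes "x \<in> carrier G" "y \<in> carrier G" "z \<in> carrier G"
  shows "commute_mod z (x \<otimes> y \<otimes> inv x \<otimes> inv y)"
proof -
  have "x \<otimes> y \<otimes> inv x \<otimes> inv y \<in> lower_central G 2"
    using commutator_in_lower_central[of 1 x y] assms by (simp add: numeral_2_eq_2)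
  then show ?thesis
    using commutator_in_lower_central[of 2 z] assms by (simp add: commute_mod_def numeral_3_eq_3 numeral_2_eq_2)
qed

text \<open>The conjugate differs from \<open>y\<close> by the commutator of \<open>g\<close> and
  \<open>y\<close>, which is central modulo \<open>\<Gamma>\<^sub>3\<close>.\<close>

lemma commute_mod_conj:
  assumes "commute_mod x y" "x \<in> carrier G" "y \<in> carrier G" "g \<in> carrier G"
  shows "commute_mod x (g \<otimes> y \<otimes> inv g)"
proof -
  let ?C = "{y \<in> carrier G. commute_mod x y}"
  have "g \<otimes> y \<otimes> inv g \<otimes> inv y \<in> ?C" "y \<in> ?C"
    using commute_mod_commutator[of g y x] assms by auto
  then have "(g \<otimes> y \<otimes> inv g \<otimes> inv y) \<otimes> y \<in> ?C"
    using commute_mod_subgroup[OF assms(2)] subgroup.m_closed by fast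
  then show ?thesis using assms by (simp add: m_assoc)
qed

lemma commute_mod_generate:
  assumes "X \<subseteq> carrier G" "x \<in> carrier G" "\<And>y. y \<in> X \<Longrightarrow> commute_mod x y" "y \<in> generate G X"
  shows "commute_mod x y"
  using generate_subgroup_incl[OF _ commute_mod_subgroup[OF assms(2)], of X] assms by auto

lemma lower_central_2_eq_3I:
  assumes gen: "carrier G = generate G X" and X: "X \<subseteq> carrier G"
    and comm: "\<And>x y. x \<in> X \<Longrightarrow> y \<in> X \<Longrightarrow> commute_mod x y"
  shows "lower_central G 2 = lower_central G 3"
proof -
  have 1: "commute_mod x y" if "x \<in> X" "y \<in> carrier G" for x y
    using commute_mod_generate[of X x y] comm that X gen by auto
  \<comment> \<open>By symmetry the passage from generators to the whole group, just made in the
    second argument, can be repeated in the first.\<close>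
  have 2: "commute_mod x y" if "x \<in> carrier G" "y \<in> carrier G" for x y
    using commute_mod_generate[of X x y] that X 1 gen commute_mod_sym by blast
  have "subgroup (lower_central G 3) G" using lower_central_normal by (simp add: normal_def)
  moreover have "{h \<otimes> k \<otimes> inv h \<otimes> inv k |h k. h \<in> carrier G \<and> k \<in> carrier G} \<subseteq> lower_central G 3"
    using 2 by (auto simp: commute_mod_def)
  ultimately have "lower_central G 2 \<subseteq> lower_central G 3"
    by (simp add: numeral_2_eq_2 commutator_subgroup_def generate_subgroup_incl)
  moreover have "lower_central G 3 \<subseteq> lower_central G 2"
    using lower_central_Suc_subset[of 2] by simp
  ultimately show ?thesis by auto
qed

end

text \<open>An infinite dihedral quotient, realised by affine maps of slope \<open>\<plusminus>1\<close> of the integers: its lower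
  central series consists of the translations by multiples of \<open>2 ^ i\<close>.\<close>

lemma (in group) not_lcs_stops_dihedral:
  fixes \<phi> :: "'a \<Rightarrow> int \<Rightarrow> int"
  assumes mult: "\<And>x y. x \<in> carrier G \<Longrightarrow> y \<in> carrier G \<Longrightarrow> \<phi> (x \<otimes> y) = \<phi> x \<circ> \<phi> y"
    and affine: "\<And>x. x \<in> carrier G \<Longrightarrow> \<exists>e a. (e = 1 \<or> e = -1) \<and> \<phi> x = (\<lambda>k. e * k + a)"
    and s: "s \<in> carrier G" "\<phi> s = (\<lambda>k. - k + a)"
    and t: "t \<in> carrier G" "\<phi> t = (\<lambda>k. k + b)" "b \<noteq> 0"
  shows "\<not> lcs_stops G"
proof
  \<comment> \<open>\<open>\<phi> \<one>\<close> is idempotent, and the identity is the only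
    idempotent map of slope 1 or -1.\<close>
  have one: "\<phi> \<one> = id"
  proof -
    obtain e a where e: "e = 1 \<or> e = -1" "\<phi> \<one> = (\<lambda>k. e * k + a)" using affine[of \<one>] by auto
    have "\<phi> \<one> \<circ> \<phi> \<one> = \<phi> \<one>" using mult[of \<one> \<one>] by simp
    then have "\<And>k. e * (e * k + a) + a = e * k + a" unfolding e(2) o_def by meson
    from this[of 0] this[of 1] e have "e = 1 \<and> a = 0" by auto
    then show ?thesis by (simp add: e fun_eq_iff)
  qed
  have inv: "\<phi> x (\<phi> (inv x) k) = k" "\<phi> (inv x) (\<phi> x k) = k" if "x \<in> carrier G" for x k
    using mult[of x "inv x"] mult[of "inv x" x] that one by (auto simp: fun_eq_iff)
  \<comment> \<open>The proviso \<open>i = 0 \<or> f = 1\<close> joins two situations: at the first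
    level \<open>y\<close> may be a reflection, and later it is a translation by a multiple of
    \<open>2 ^ i\<close>. Either way the commutator gains a factor 2.\<close>
  have comm: "\<exists>d. \<phi> (x \<otimes> y \<otimes> inv x \<otimes> inv y) = (\<lambda>k. k + 2 ^ Suc i * d)"
    if x: "x \<in> carrier G" and y: "y \<in> carrier G"
      and "\<phi> x = (\<lambda>k. e * k + p)" "e = 1 \<or> e = -1" 
      and "\<phi> y = (\<lambda>k. f * k + 2 ^ i * q)" "f = 1 \<or> f = -1" and "i = 0 \<or> f = 1" for x y e p f q i
  proof -
    have 1: "\<phi> (inv x) = (\<lambda>k. e * (k - p))"
    proof
      show "\<phi> (inv x) k = e * (k - p)" for k
        using inv(1)[OF x, of k] that(4) unfolding that(3) by auto
    qed
    have 2: "\<phi> (inv y) = (\<lambda>k. f * (k - 2 ^ i * q))"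
    proof
      show "\<phi> (inv y) k = f * (k - 2 ^ i * q)" for k
        using inv(1)[OF y, of k] that(6) unfolding that(5) by auto
    qed
    have "\<phi> (x \<otimes> y \<otimes> inv x \<otimes> inv y) = \<phi> x \<circ> \<phi> y \<circ> \<phi> (inv x) \<circ> \<phi> (inv y)"
      using x y by (simp add: mult)
    also have "\<dots> = (\<lambda>k. k + 2 ^ Suc i * (if e = 1 then (if f = 1 then 0 else p) else if f = 1 then - q else p - q))"
      unfolding 1 2 that(3,5) using that(4,6,7) by (auto simp: fun_eq_iff algebra_simps)
    finally show ?thesis by blast
  qed
  have affine_comm: "\<exists>d. \<phi> (x \<otimes> y \<otimes> inv x \<otimes> inv y) = (\<lambda>k. k + 2 ^ Suc i * d)"
    if x: "x \<in> carrier G" and "y \<in> carrier G" "\<phi> y = (\<lambda>k. f * k + 2 ^ i * q)" "f = 1 \<or> f = -1"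
      and "i = 0 \<or> f = 1" for x y f q i
    using affine[OF x] comm[OF x that(2)] that(3-) by blast
  have trans_subgroup: "subgroup {y \<in> carrier G. \<exists>d. \<phi> y = (\<lambda>k. k + m * d)} G" (is "subgroup ?T G") for m
  proof (rule subgroupI)
    show "?T \<noteq> {}" using one by (auto simp: fun_eq_iff intro!: exI[of _ \<one>] exI[of _ 0])
  next
    fix y assume "y \<in> ?T"
    then obtain d where y: "y \<in> carrier G" "\<phi> y = (\<lambda>k. k + m * d)" by blast
    have "\<phi> (inv y) = (\<lambda>k. k + m * (- d))"
    proof
      show "\<phi> (inv y) k = k + m * (- d)" for k
        using inv(1)[OF y(1), of k] unfolding y(2) by simp
    qed
    then show "inv y \<in> ?T" using y by blast
  next
    fix y z assume "y \<in> ?T" "z \<in> ?T"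
    then obtain d d' where y: "y \<in> carrier G" "\<phi> y = (\<lambda>k. k + m * d)"
      and z: "z \<in> carrier G" "\<phi> z = (\<lambda>k. k + m * d')" by blast
    then have "\<phi> (y \<otimes> z) = (\<lambda>k. k + m * (d' + d))" by (auto simp: mult fun_eq_iff algebra_simps)
    then show "y \<otimes> z \<in> ?T" using y z by blast
  qed auto
  have deep: "lower_central G (Suc (Suc i)) \<subseteq> {y \<in> carrier G. \<exists>d. \<phi> y = (\<lambda>k. k + 2 ^ Suc i * d)}" for i
  proof (induction i)
    case 0
    have "\<exists>d. \<phi> (x \<otimes> y \<otimes> inv x \<otimes> inv y) = (\<lambda>k. k + 2 ^ Suc 0 * d)"
      if xy: "x \<in> carrier G" "y \<in> carrier G" for x y
    proof -
      obtain f q where "f = 1 \<or> f = -1" "\<phi> y = (\<lambda>k. f * k + 2 ^ 0 * q)"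
        using affine[OF xy(2)] by auto
      then show ?thesis using affine_comm[OF xy] by blast
    qed
    then show ?case
      unfolding lower_central.simps commutator_subgroup_def
      by (intro generate_subgroup_incl trans_subgroup) auto
  next
    case (Suc i)
    have "\<exists>d. \<phi> (x \<otimes> y \<otimes> inv x \<otimes> inv y) = (\<lambda>k. k + 2 ^ Suc (Suc i) * d)"
      if "x \<in> carrier G" "y \<in> lower_central G (Suc (Suc i))" for x y
      using affine_comm[OF that(1), of y 1 "Suc i"] Suc that(2) by fastforce
    moreover have "lower_central G (Suc (Suc i)) \<subseteq> carrier G" using Suc by blast
    ultimately show ?case
      unfolding lower_central.simps(3)[of G "Suc i"] commutator_subgroup_def
      by (intro generate_subgroup_incl trans_subgroup) auto
  qed
  \<comment> \<open>Commutation with a reflection inverts a translation and divides by it, which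
    multiplies its length by -2. Iterating from \<open>t\<close> gives a nontrivial translation in
    every term.\<close>
  have nontriv: "\<exists>y \<in> lower_central G (Suc i). \<phi> y = (\<lambda>k. k + (-2) ^ i * b)" for i
  proof (induction i)
    case 0
    then show ?case using t by auto
  next
    case (Suc i)
    then obtain y where y: "y \<in> lower_central G (Suc i)" "\<phi> y = (\<lambda>k. k + (-2) ^ i * b)" by blast
    have yG: "y \<in> carrier G" using y(1) lower_central_normal normal_imp_subgroup subgroup.subset by blast
    have 1: "\<phi> (inv s) = (\<lambda>k. - k + a)"
    proof
      show "\<phi> (inv s) k = - k + a" for k
        using inv(1)[OF s(1), of k] unfolding s(2) by simp
    qed
    have 2: "\<phi> (inv y) = (\<lambda>k. k - (-2) ^ i * b)"
    proof
      show "\<phi> (inv y) k = k - (-2) ^ i * b" for k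
        using inv(1)[OF yG, of k] unfolding y(2) by simp
    qed
    have "\<phi> (s \<otimes> y \<otimes> inv s \<otimes> inv y) = \<phi> s \<circ> \<phi> y \<circ> \<phi> (inv s) \<circ> \<phi> (inv y)"
      using s yG by (simp add: mult)
    also have "\<dots> = (\<lambda>k. k + (-2) ^ Suc i * b)"
      unfolding 1 2 s(2) y(2) by (auto simp: fun_eq_iff algebra_simps)
    finally show ?case using commutator_in_lower_central[OF _ s(1) y(1)] by auto
  qed
  assume "lcs_stops G"
  then obtain i where i: "1 \<le> i" "lower_central G i = lower_central G (i + 1)"
    by (auto simp: lcs_stops_def)
  obtain y where y: "y \<in> lower_central G i" "\<phi> y = (\<lambda>k. k + (-2) ^ (i - 1) * b)"
    using nontriv[of "i - 1"] i(1) by auto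
  define c where "c = (-2) ^ (i - 1) * b"
  have "c \<noteq> 0" using t(3) by (simp add: c_def)
  \<comment> \<open>If the series stops at \<open>i\<close>, then \<open>y\<close> lies in all
    deeper terms. Depth about \<open>\<bar>c\<bar>\<close> is enough, since \<open>2 ^ m\<close>
    exceeds \<open>m\<close>.\<close>
  have "2 ^ nat \<bar>c\<bar> dvd c"
  proof -
    have "y \<in> lower_central G (i + (nat \<bar>c\<bar> + 2))" using lower_central_stable[OF i] y by blast
    then obtain d where "\<phi> y = (\<lambda>k. k + 2 ^ Suc (i + nat \<bar>c\<bar>) * d)" using deep[of "i + nat \<bar>c\<bar>"] by auto
    then have "\<phi> y 0 = 2 ^ Suc (i + nat \<bar>c\<bar>) * d" by simp
    moreover have "\<phi> y 0 = c" by (simp add: y(2) c_def)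
    ultimately have "c = 2 ^ Suc (i + nat \<bar>c\<bar>) * d" by metis
    also have "2 ^ nat \<bar>c\<bar> dvd 2 ^ Suc (i + nat \<bar>c\<bar>) * d" by (intro dvd_mult2 le_imp_power_dvd) auto
    finally show ?thesis .
  qed
  then have "\<bar>2 ^ nat \<bar>c\<bar>\<bar> \<le> \<bar>c\<bar>" by (rule dvd_imp_le_int[OF \<open>c \<noteq> 0\<close>])
  moreover have "int (nat \<bar>c\<bar>) < int (2 ^ nat \<bar>c\<bar>)" by (simp only: of_nat_less_iff less_exp)
  ultimately show False by simp
qed

section \<open>Lifting permutations to braids\<close>

lemma (in group) intertwine_pow:
  assumes "x \<otimes> d = d \<otimes> y" "x \<in> carrier G" "y \<in> carrier G" "d \<in> carrier G"
  shows "x [^] (k::nat) \<otimes> d = d \<otimes> y [^] k"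
proof (induction k)
  case (Suc k)
  have "x [^] Suc k \<otimes> d = x [^] k \<otimes> (x \<otimes> d)" using assms by (simp add: m_assoc)
  also have "\<dots> = (x [^] k \<otimes> d) \<otimes> y" unfolding assms(1) using assms(2-) by (simp add: m_assoc)
  also have "\<dots> = d \<otimes> y [^] Suc k" unfolding Suc using assms(2-) by (simp add: m_assoc)
  finally show ?case .
qed (use assms in simp)

text \<open>A transposition corrects the value at the new last place; the earlier values differ from
  both of its points and stay.\<close>

lemma permutation_prefix:
  assumes "distinct xs" "set xs \<subseteq> {1..n}"
  shows "\<exists>p. p permutes {1..n} \<and> (\<forall>k < length xs. p (Suc k) = xs ! k)"
  using assms
proof (induction xs rule: rev_induct)
  case Nil
  show ?case using permutes_id by (intro exI[of _ id]) (simp del: id_apply)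
next
  case (snoc x xs)
  then obtain p where p: "p permutes {1..n}" "\<And>k. k < length xs \<Longrightarrow> p (Suc k) = xs ! k" by auto
  let ?l = "Suc (length xs)"
  have "card (set (xs @ [x])) \<le> card {1..n}" using snoc.prems by (intro card_mono) auto
  then have "?l \<in> {1..n}" using snoc.prems distinct_card[of "xs @ [x]"] by simp
  then have "p ?l \<in> {1..n}" using p(1) by (simp only: permutes_in_image)
  moreover have "x \<in> {1..n}" using snoc.prems by simp
  ultimately have 1: "transpose (p ?l) x \<circ> p permutes {1..n}"
    using p(1) by (intro permutes_compose permutes_swap_id)
  have 2: "(transpose (p ?l) x \<circ> p) (Suc k) = (xs @ [x]) ! k" if "k < length (xs @ [x])" for k
  proof (cases "k = length xs")
    case False
    then have "p (Suc k) = xs ! k" "k < length xs" using p that by auto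
    moreover have "p (Suc k) \<noteq> p ?l" using permutes_inj[OF p(1)] False by (simp add: inj_eq)
    moreover have "xs ! k \<noteq> x" using snoc.prems \<open>k < length xs\<close> nth_mem by fastforce
    ultimately show ?thesis by (simp add: nth_append)
  qed simp
  show ?case using 1 2 by blast
qed

text \<open>The relations and the generation by \<open>sig\<close> are all that the proof of
  \<open>\<Gamma>\<^sub>2 = \<Gamma>\<^sub>3\<close> uses. That Artin's relations suffice matters
  only for maps out of the braid group.\<close>

locale artin_group = group B for B (structure) +
  fixes n :: nat and sig :: "nat \<Rightarrow> 'a" and perm :: "'a \<Rightarrow> nat \<Rightarrow> nat"
  assumes sig_closed [simp]: "1 \<le> i \<Longrightarrow> i < n \<Longrightarrow> sig i \<in> carrier B"
    and far: "1 \<le> i \<Longrightarrow> i + 2 \<le> j \<Longrightarrow> j < n \<Longrightarrow> sig i \<otimes> sig j = sig j \<otimes> sig i"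
    and braid: "1 \<le> i \<Longrightarrow> i + 1 < n \<Longrightarrow>
      sig i \<otimes> sig (i + 1) \<otimes> sig i = sig (i + 1) \<otimes> sig i \<otimes> sig (i + 1)"
    and gen: "carrier B = generate B (sig ` {1..<n})"
    and perm_mult: "x \<in> carrier B \<Longrightarrow> y \<in> carrier B \<Longrightarrow> perm (x \<otimes> y) = perm x \<circ> perm y"
    and perm_sig: "1 \<le> i \<Longrightarrow> i < n \<Longrightarrow> perm (sig i) = transpose i (i + 1)"
    and perm_permutes: "x \<in> carrier B \<Longrightarrow> perm x permutes {1..n}"
begin

lemma perm_one: "perm \<one> = id"
proof -
  have "perm \<one> \<circ> perm \<one> = perm \<one>" using perm_mult[of \<one> \<one>] by simp
  then show ?thesis
    using permutes_inv_o(1)[OF perm_permutes[OF one_closed]]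
      permutes_inv_o(2)[OF perm_permutes[OF one_closed]] by (metis comp_assoc comp_id)
qed

lemma perm_inv:
  assumes "x \<in> carrier B"
  shows "perm (inv x) = inv_into UNIV (perm x)" "perm (inv x) \<circ> perm x = id" "perm x \<circ> perm (inv x) = id"
    "perm (inv x) (perm x k) = k" "perm x (perm (inv x) k) = k"
proof -
  show 1: "perm (inv x) \<circ> perm x = id" and 2: "perm x \<circ> perm (inv x) = id"
    using assms perm_mult[of x "inv x"] perm_mult[of "inv x" x] by (simp_all add: perm_one)
  then show "perm (inv x) (perm x k) = k" "perm x (perm (inv x) k) = k" by (simp_all add: fun_eq_iff)
  show "perm (inv x) = inv_into UNIV (perm x)"
    using 1 2 by (metis inv_unique_comp)
qed

lemma perm_in_range: "x \<in> carrier B \<Longrightarrow> 1 \<le> k \<Longrightarrow> k \<le> n \<Longrightarrow> perm x k \<in> {1..n}"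
  using permutes_in_image[OF perm_permutes, of x k] by simp

lemma perm_inj: "x \<in> carrier B \<Longrightarrow> perm x j = perm x k \<longleftrightarrow> j = k"
  using permutes_inj[OF perm_permutes, of x] by (simp add: inj_eq)

lemma subset_gens: "1 \<le> m \<Longrightarrow> sig ` {m..<n} \<subseteq> carrier B"
  by auto

lemma generate_gens_subset: "1 \<le> m \<Longrightarrow> d \<in> generate B (sig ` {m..<n}) \<Longrightarrow> d \<in> carrier B"
  using generate_in_carrier[OF subset_gens] .

text \<open>The bound \<open>m\<close> keeps the lift among the generators from \<open>m\<close> on.
  For \<open>m = 3\<close> these all commute with \<open>sig 1\<close>, which is how permutations
  are lifted to its centraliser.\<close>

lemma lift_transposition:
  assumes "1 \<le> m" "m \<le> a" "a < b" "b \<le> n"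
  shows "\<exists>d \<in> generate B (sig ` {m..<n}). perm d = transpose a b"
proof -
  from assms(3) have "Suc a \<le> b" by simp
  then show ?thesis using assms(4)
  proof (induction b rule: dec_induct)
    case base
    have "sig a \<in> generate B (sig ` {m..<n})" using base assms by (intro generate.incl imageI) simp
    then show ?case using base assms perm_sig[of a] by auto
  next
    case (step b)
    then obtain d where d: "d \<in> generate B (sig ` {m..<n})" "perm d = transpose a b" by auto
    have s: "sig b \<in> generate B (sig ` {m..<n})" using step assms by (intro generate.incl imageI) simp
    have "perm (sig b \<otimes> d \<otimes> sig b) = transpose b (b + 1) \<circ> transpose a b \<circ> transpose b (b + 1)"
      using step assms d generate_gens_subset[OF assms(1) d(1)] by (simp add: perm_mult perm_sig)
    also have "\<dots> = transpose a (Suc b)"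
      using step assms by (auto simp: fun_eq_iff transpose_def)
    finally show ?case using s d by (auto intro!: bexI[of _ "sig b \<otimes> d \<otimes> sig b"] generate.eng)
  qed
qed

lemma lift_permutation:
  assumes "1 \<le> m" "p permutes {m..n}"
  shows "\<exists>d \<in> generate B (sig ` {m..<n}). perm d = p"
  using assms(2) finite_atLeastAtMost
proof (induction p rule: permutes_induct)
  case id
  show ?case using generate.one perm_one by blast
next
  case (swap a b p)
  have "\<exists>d \<in> generate B (sig ` {m..<n}). perm d = transpose a b"
    using swap(1-3) lift_transposition[OF assms(1), of a b] lift_transposition[OF assms(1), of b a]
    by (cases "a < b") (auto simp: transpose_commute)
  then obtain d e where d: "d \<in> generate B (sig ` {m..<n})" "perm d = transpose a b"
    and e: "e \<in> generate B (sig ` {m..<n})" "perm e = p" using swap by blast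
  then have "perm (d \<otimes> e) = transpose a b \<circ> p"
    using generate_gens_subset[OF assms(1)] by (simp add: perm_mult)
  then show ?case using d e by (blast intro: generate.eng)
qed

lemma lift_prefix:
  assumes "distinct xs" "set xs \<subseteq> {1..n}"
  obtains b where "b \<in> carrier B" "\<And>k. k < length xs \<Longrightarrow> perm b (Suc k) = xs ! k"
proof -
  obtain p where p: "p permutes {1..n}" "\<And>k. k < length xs \<Longrightarrow> p (Suc k) = xs ! k"
    using permutation_prefix[OF assms] by blast
  show ?thesis using lift_permutation[OF _ p(1)] p(2) that gen by auto
qed

text \<open>The braid relation says that \<open>sig (i + 1) \<otimes> sig i\<close> intertwines
  \<open>sig i\<close> with \<open>sig (i + 1)\<close>; these elements are chained.\<close>

lemma sig_intertwine_first:
  assumes "1 \<le> i" "i < n"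
  shows "\<exists>d \<in> carrier B. sig 1 \<otimes> d = d \<otimes> sig i"
  using assms
proof (induction i rule: dec_induct)
  case base
  then show ?case by (intro bexI[of _ \<one>]) auto
next
  case (step i)
  then obtain d where d: "d \<in> carrier B" "sig 1 \<otimes> d = d \<otimes> sig i" by auto
  have s: "sig i \<in> carrier B" "sig (Suc i) \<in> carrier B" "sig 1 \<in> carrier B" using step by auto
  let ?e = "sig (Suc i) \<otimes> sig i"
  have "sig 1 \<otimes> (d \<otimes> ?e) = d \<otimes> (sig i \<otimes> sig (Suc i) \<otimes> sig i)"
    using d s by (simp add: m_assoc[symmetric])
  also have "\<dots> = d \<otimes> ?e \<otimes> sig (Suc i)"
    using braid[of i] step d s by (simp add: m_assoc)
  finally show ?case using d s by blast
qed

lemma perm_intertwine: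
  assumes "sig j \<otimes> d = d \<otimes> sig i" "d \<in> carrier B" "1 \<le> i" "i < n" "1 \<le> j" "j < n"
  shows "{perm d i, perm d (i + 1)} = {j, j + 1}"
proof -
  have "transpose j (j + 1) \<circ> perm d = perm d \<circ> transpose i (i + 1)"
    using arg_cong[OF assms(1), of perm] assms(2-) by (simp add: perm_mult perm_sig)
  then have "transpose j (j + 1) (perm d i) = perm d (i + 1)"
    by (metis comp_apply transpose_apply_first)
  moreover have "perm d i \<noteq> perm d (i + 1)" using assms by (simp add: perm_inj)
  ultimately show ?thesis by (auto simp: transpose_def split: if_splits)
qed

lemma commutes_first:
  assumes "d \<in> generate B (sig ` {3..<n})" "2 \<le> n"
  shows "sig 1 \<otimes> d = d \<otimes> sig 1"
proof -
  have "generate B (sig ` {3..<n}) \<subseteq> {d \<in> carrier B. sig 1 \<otimes> d = d \<otimes> sig 1}"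
  proof (intro generate_subgroup_incl centralizer_subgroup subsetI)
    fix x assume "x \<in> sig ` {3..<n}"
    then obtain j where "x = sig j" "3 \<le> j" "j < n" by auto
    then show "x \<in> {d \<in> carrier B. sig 1 \<otimes> d = d \<otimes> sig 1}" using far[of 1 j] by simp
  qed (use assms in simp)
  then show ?thesis using assms by auto
qed

text \<open>A permutation fixing 1 and 2 lifts to a product of generators that commute with
  \<open>sig 1\<close>. One that swaps them differs from such a permutation by the permutation of
  \<open>sig 1\<close>, which commutes with itself.\<close>

lemma lift_stabilizer_first:
  assumes "2 \<le> n" "p permutes {1..n}" "p ` {1, 2} = {1, 2}"
  shows "\<exists>d \<in> carrier B. perm d = p \<and> sig 1 \<otimes> d = d \<otimes> sig 1"
proof -
  have fixing: "\<exists>d \<in> carrier B. perm d = q \<and> sig 1 \<otimes> d = d \<otimes> sig 1"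
    if q: "q permutes {1..n}" "q 1 = 1" "q 2 = 2" for q
  proof -
    have "q permutes {3..n}"
    proof (rule permutes_superset[OF q(1)])
      fix x assume "x \<in> {1..n} - {3..n}"
      then have "x = 1 \<or> x = 2" by auto
      then show "q x = x" using q by auto
    qed
    then obtain d where "d \<in> generate B (sig ` {3..<n})" "perm d = q"
      using lift_permutation[of 3 q] by auto
    then show ?thesis using commutes_first assms(1) generate_gens_subset[of 3 d] by auto
  qed
  have "p 1 \<noteq> p 2" using permutes_inj[OF assms(2)] by (simp add: inj_eq)
  then consider "p 1 = 1" "p 2 = 2" | "p 1 = 2" "p 2 = 1"
    using assms(3) by (auto simp: doubleton_eq_iff)
  then show ?thesis
  proof cases
    case 2
    let ?t = "transpose 1 (2::nat)"
    have "?t \<circ> p permutes {1..n}" using assms by (intro permutes_compose permutes_swap_id) auto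
    then obtain d where d: "d \<in> carrier B" "perm d = ?t \<circ> p" "sig 1 \<otimes> d = d \<otimes> sig 1"
      using fixing[of "?t \<circ> p"] 2 by auto
    have "perm (sig 1 \<otimes> d) = p"
      using d(1,2) assms(1) perm_sig[of 1] by (simp add: perm_mult fun_eq_iff numeral_2_eq_2)
    moreover have "sig 1 \<otimes> (sig 1 \<otimes> d) = sig 1 \<otimes> (d \<otimes> sig 1)" by (simp only: d(3))
    moreover have "\<dots> = sig 1 \<otimes> d \<otimes> sig 1" using d(1) assms(1) by (simp add: m_assoc)
    ultimately show ?thesis using d(1) assms(1) by (intro bexI[of _ "sig 1 \<otimes> d"]) auto
  qed (use fixing assms in blast)
qed

text \<open>Conjugators of both generators to \<open>sig 1\<close> reduce this to the previous
  lemma: transported by their permutations, \<open>p\<close> becomes a permutation preserving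
  \<open>{1, 2}\<close>. The free choice of \<open>p\<close> is what later makes conjugators
  preserve colours.\<close>

lemma lift_intertwiner:
  assumes ij: "1 \<le> i" "i < n" "1 \<le> j" "j < n"
    and p: "p permutes {1..n}" "p ` {j, j + 1} = {i, i + 1}"
  obtains d where "d \<in> carrier B" "perm d = p" "sig i \<otimes> d = d \<otimes> sig j"
proof -
  obtain d where d: "d \<in> carrier B" "sig 1 \<otimes> d = d \<otimes> sig i" using sig_intertwine_first ij by blast
  obtain e where e: "e \<in> carrier B" "sig 1 \<otimes> e = e \<otimes> sig j" using sig_intertwine_first ij by blast
  have n: "1 < n" using ij by simp
  have di: "perm d ` {i, i + 1} = {1, 2}"
    using perm_intertwine[OF d(2,1) ij(1,2) order_refl n] by (simp only: image_insert image_empty one_add_one)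
  have ej: "perm e ` {j, j + 1} = {1, 2}"
    using perm_intertwine[OF e(2,1) ij(3,4) order_refl n] by (simp only: image_insert image_empty one_add_one)
  have "perm (inv e) ` {1, 2} = {j, j + 1}"
    unfolding ej[symmetric] by (simp only: image_image perm_inv(4)[OF e(1)] image_ident)
  then have "(perm d \<circ> p \<circ> perm (inv e)) ` {1, 2} = {1, 2}"
    by (simp only: image_comp[symmetric] p(2) di)
  moreover have "perm d \<circ> p \<circ> perm (inv e) permutes {1..n}"
    using perm_permutes d e p by (intro permutes_compose) auto
  ultimately obtain f where f: "f \<in> carrier B" "perm f = perm d \<circ> p \<circ> perm (inv e)" "sig 1 \<otimes> f = f \<otimes> sig 1"
    using lift_stabilizer_first[of "perm d \<circ> p \<circ> perm (inv e)"] ij by auto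
  have s: "sig i \<in> carrier B" "sig j \<in> carrier B" "sig 1 \<in> carrier B" using ij by auto
  have "perm (inv d \<otimes> f \<otimes> e) = perm (inv d) \<circ> (perm d \<circ> p \<circ> perm (inv e)) \<circ> perm e"
    using d e f by (simp add: perm_mult)
  then have 1: "perm (inv d \<otimes> f \<otimes> e) = p"
    by (simp add: perm_inv(4)[OF d(1)] perm_inv(4)[OF e(1)] fun_eq_iff)
  have "sig i \<otimes> (inv d \<otimes> f \<otimes> e) = inv d \<otimes> (d \<otimes> sig i) \<otimes> inv d \<otimes> f \<otimes> e"
    using d e f s by (simp add: m_assoc mult_inv_cancel)
  also have "\<dots> = inv d \<otimes> (sig 1 \<otimes> f) \<otimes> e"
    unfolding d(2)[symmetric] using d(1) e(1) f(1) s by (simp add: m_assoc mult_inv_cancel)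
  also have "\<dots> = inv d \<otimes> f \<otimes> (sig 1 \<otimes> e)"
    unfolding f(3) using d(1) e(1) f(1) s by (simp add: m_assoc)
  also have "\<dots> = inv d \<otimes> f \<otimes> e \<otimes> sig j"
    unfolding e(2) using d(1) e(1) f(1) s by (simp add: m_assoc)
  finally show ?thesis using that[OF _ 1] d e f by simp
qed

end

section \<open>Twists and colour-preserving braids\<close>

text \<open>Colours stand for block indices. Monotonicity expresses that the blocks are consecutive:
  a braid preserving the colours ends with its colours in order.\<close>

locale coloured_braids = artin_group +
  fixes c :: "nat \<Rightarrow> nat"
  assumes colour_mono: "1 \<le> i \<Longrightarrow> i < n \<Longrightarrow> c i \<le> c (i + 1)"
begin

definition colour_group :: "'a set" where
  "colour_group = {x \<in> carrier B. c \<circ> perm x = c}"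

lemma colour_groupI: "x \<in> carrier B \<Longrightarrow> (\<And>k. c (perm x k) = c k) \<Longrightarrow> x \<in> colour_group"
  by (auto simp: colour_group_def)

lemma colour_group_colour: "x \<in> colour_group \<Longrightarrow> c (perm x k) = c k"
  by (auto simp: colour_group_def fun_eq_iff)

lemma colour_group_subset: "colour_group \<subseteq> carrier B"
  by (auto simp: colour_group_def)

lemma colour_group_subgroup: "subgroup colour_group B"
proof (rule subgroupI)
  show "colour_group \<noteq> {}" using colour_groupI[of \<one>] by (auto simp: perm_one)
next
  fix x assume x: "x \<in> colour_group"
  then have xB: "x \<in> carrier B" using colour_group_subset by blast
  show "inv x \<in> colour_group"
    using xB colour_group_colour[OF x, of "perm (inv x) _"] by (intro colour_groupI) (simp_all add: perm_inv(5))
next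
  fix x y assume xy: "x \<in> colour_group" "y \<in> colour_group"
  then have "x \<in> carrier B" "y \<in> carrier B" using colour_group_subset by auto
  then show "x \<otimes> y \<in> colour_group"
    using xy by (intro colour_groupI) (simp_all add: perm_mult colour_group_colour)
qed (rule colour_group_subset)

abbreviation "L \<equiv> B\<lparr>carrier := colour_group\<rparr>"

sublocale L: group L
  using colour_group_subgroup is_group by (rule subgroup.subgroup_is_group)

definition strand_exp :: "nat \<Rightarrow> nat \<Rightarrow> nat" where
  "strand_exp u v = (if c u = c v then 1 else 2)"

text \<open>The conjugates of half twists (strands of equal colours) and of full twists (strands of
  different colours) of two strands starting at \<open>u\<close> and \<open>v\<close>.\<close>

definition twist :: "nat \<Rightarrow> nat \<Rightarrow> 'a \<Rightarrow> bool" where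
  "twist u v x \<longleftrightarrow> (\<exists>b \<in> carrier B. \<exists>i. 1 \<le> i \<and> i < n \<and> {perm b i, perm b (i + 1)} = {u, v} \<and>
     x = b \<otimes> sig i [^] strand_exp u v \<otimes> inv b)"

lemma strand_exp_commute: "strand_exp u v = strand_exp v u"
  by (simp add: strand_exp_def)

lemma twist_commute: "twist u v x \<Longrightarrow> twist v u x"
  by (simp add: twist_def strand_exp_commute insert_commute)

lemma twist_strands:
  assumes "twist u v x"
  shows "u \<noteq> v" "u \<in> {1..n}" "v \<in> {1..n}"
proof -
  obtain b i where b: "b \<in> carrier B" "1 \<le> i" "i < n" "{perm b i, perm b (i + 1)} = {u, v}"
    using assms unfolding twist_def by blast
  then show "u \<noteq> v" "u \<in> {1..n}" "v \<in> {1..n}"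
    using perm_inj[of b i "i + 1"] perm_in_range[of b i] perm_in_range[of b "i + 1"]
    by (auto simp: doubleton_eq_iff)
qed

lemma perm_square: "1 \<le> i \<Longrightarrow> i < n \<Longrightarrow> perm (sig i [^] (2::nat)) = id"
  by (simp add: numeral_2_eq_2 perm_mult perm_sig perm_one)

lemma conj_square_in_colour_group:
  assumes "b \<in> carrier B" "1 \<le> i" "i < n"
  shows "b \<otimes> sig i [^] (2::nat) \<otimes> inv b \<in> colour_group"
  using assms by (intro colour_groupI) (simp_all add: perm_mult perm_square perm_inv(5))

lemma conj_half_twist_in_colour_group:
  assumes "b \<in> carrier B" "1 \<le> i" "i < n" "c (perm b i) = c (perm b (i + 1))"
  shows "b \<otimes> sig i \<otimes> inv b \<in> colour_group"
proof (rule colour_groupI)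
  fix k
  have "c (perm b (transpose i (i + 1) l)) = c (perm b l)" for l
    using assms(4) by (simp add: transpose_def)
  from this[of "perm (inv b) k"] show "c (perm (b \<otimes> sig i \<otimes> inv b) k) = c k"
    using assms by (simp add: perm_mult perm_sig perm_inv(5))
qed (use assms in simp)

lemma twist_in_colour_group:
  assumes "twist u v x"
  shows "x \<in> colour_group"
proof -
  obtain b i where b: "b \<in> carrier B" "1 \<le> i" "i < n" "{perm b i, perm b (i + 1)} = {u, v}"
    and x: "x = b \<otimes> sig i [^] strand_exp u v \<otimes> inv b"
    using assms unfolding twist_def by blast
  show ?thesis
  proof (cases "c u = c v")
    case True
    then have "c (perm b i) = c (perm b (i + 1))" using b(4) by (auto simp: doubleton_eq_iff)
    then show ?thesis using conj_half_twist_in_colour_group[of b i] b True by (simp add: x strand_exp_def)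
  next
    case False
    then show ?thesis using conj_square_in_colour_group[of b i] b by (simp add: x strand_exp_def)
  qed
qed

lemma twist_conj:
  assumes "twist u v x" "twist u' v' y" "c u = c u'" "c v = c v'"
  obtains g where "g \<in> colour_group" "g \<otimes> x \<otimes> inv g = y"
proof -
  obtain b i where b: "b \<in> carrier B" "1 \<le> i" "i < n" "{perm b i, perm b (i + 1)} = {u, v}"
    and x: "x = b \<otimes> sig i [^] strand_exp u v \<otimes> inv b"
    using assms(1) unfolding twist_def by blast
  obtain b' j where b': "b' \<in> carrier B" "1 \<le> j" "j < n" "{perm b' j, perm b' (j + 1)} = {u', v'}"
    and y: "y = b' \<otimes> sig j [^] strand_exp u v \<otimes> inv b'"
    using assms(2-4) unfolding twist_def strand_exp_def by auto
  \<comment> \<open>\<open>q1\<close> carries \<open>u\<close> to \<open>u'\<close>; the second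
    transposition carries the image of \<open>v\<close> to \<open>v'\<close> and leaves
    \<open>u'\<close> alone. Each exchanges strands of one colour, so \<open>q\<close> preserves
    colours.\<close>
  define q1 where "q1 = transpose u u'"
  define q where "q = transpose (q1 v) v' \<circ> q1"
  note strands = twist_strands[OF assms(1)] twist_strands[OF assms(2)]
  have q1v: "q1 v \<noteq> u'" "q1 v \<in> {1..n}" "c (q1 v) = c v'"
    using strands assms(3,4) by (auto simp: q1_def transpose_def)
  have q: "q u = u'" "q v = v'" using strands q1v by (auto simp: q_def q1_def)
  have ct: "c (transpose a b k) = c k" if "c a = c b" for a b k
    using that by (simp add: transpose_def)
  have cq: "c (q k) = c k" for k
    using ct[OF q1v(3), of "q1 k"] ct[OF assms(3), of k] by (simp add: q_def q1_def)
  have qperm: "q permutes {1..n}"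
    unfolding q_def q1_def using strands q1v by (intro permutes_compose permutes_swap_id) (auto simp: q1_def)
  \<comment> \<open>Chosen so that the conjugator \<open>g\<close> built from \<open>b'\<close>, the
    lift \<open>d\<close> of \<open>p\<close> and \<open>b\<close> has the colour-preserving
    permutation \<open>q\<close>.\<close>
  define p where "p = perm (inv b) \<circ> inv_into UNIV q \<circ> perm b'"
  have "p permutes {1..n}"
    unfolding p_def using qperm b b' perm_permutes by (intro permutes_compose permutes_inv) auto
  moreover have "p ` {j, j + 1} = {i, i + 1}"
  proof -
    have "inv_into UNIV q ` {u', v'} = {u, v}"
      using permutes_inverses(2)[OF qperm, of u] permutes_inverses(2)[OF qperm, of v] q by simp
    moreover have "perm b' ` {j, j + 1} = {u', v'}" using b' by simp
    moreover have "perm (inv b) ` {u, v} = {i, i + 1}"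
      unfolding b(4)[symmetric] by (simp add: perm_inv(4)[OF b(1)])
    ultimately show ?thesis unfolding p_def by (simp only: image_comp[symmetric])
  qed
  ultimately obtain d where d: "d \<in> carrier B" "perm d = p" "sig i \<otimes> d = d \<otimes> sig j"
    using lift_intertwiner b b' by metis
  have s: "sig i \<in> carrier B" "sig j \<in> carrier B" using b b' by auto
  define g where "g = b' \<otimes> inv d \<otimes> inv b"
  have "inv g = b \<otimes> d \<otimes> inv b'" using b b' d by (simp add: g_def inv_mult_group m_assoc)
  have "perm (inv g) = inv_into UNIV q"
    unfolding \<open>inv g = _\<close> using b b' d
    by (simp add: perm_mult p_def fun_eq_iff perm_inv(5))
  moreover have gB: "g \<in> carrier B" using b b' d by (simp add: g_def)
  ultimately have "perm g = q"
    using perm_inv(1)[of "inv g"] permutes_inv_inv[OF qperm] by simp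
  then have "g \<in> colour_group" using gB cq by (intro colour_groupI) auto
  moreover have "g \<otimes> x \<otimes> inv g = y"
  proof -
    let ?e = "strand_exp u v"
    have "g \<otimes> x \<otimes> inv g = b' \<otimes> inv d \<otimes> (sig i [^] ?e \<otimes> d) \<otimes> inv b'"
      unfolding \<open>inv g = _\<close> unfolding g_def x using b(1) b'(1) d(1) s by (simp add: m_assoc mult_inv_cancel)
    also have "\<dots> = y"
      unfolding y intertwine_pow[OF d(3) s d(1)] using b(1) b'(1) d(1) s by (simp add: m_assoc mult_inv_cancel)
    finally show ?thesis .
  qed
  ultimately show ?thesis using that by blast
qed

section \<open>Commutation of twists modulo the third term\<close>

lemma commute_mod_transfer:
  assumes "L.commute_mod x z" "twist u v x" "twist u' v' y" "c u = c u'" "c v = c v'" "z \<in> colour_group"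
  shows "L.commute_mod y z"
proof -
  obtain g where g: "g \<in> colour_group" "g \<otimes> x \<otimes> inv g = y" using twist_conj assms by blast
  have x: "x \<in> colour_group" using assms twist_in_colour_group by blast
  have "L.commute_mod z (g \<otimes> x \<otimes> inv\<^bsub>L\<^esub> g)"
    using L.commute_mod_conj[of z x g] L.commute_mod_sym[of x z] assms g x by simp
  then have "L.commute_mod z y" using g colour_group_subgroup by simp
  then show ?thesis using L.commute_mod_sym[of z y] assms twist_in_colour_group by simp
qed

text \<open>Both arguments may be replaced by conjugates in the colour group. So commutation of
  twists modulo \<open>\<Gamma>\<^sub>3\<close> depends only on the colours of their strands, and
  one convenient pair of representatives decides it.\<close>

lemma commute_mod_transfer2:
  assumes "L.commute_mod x y" "twist u v x" "twist u' v' y"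
    and "twist u1 v1 x1" "c u = c u1" "c v = c v1"
    and "twist u1' v1' y1" "c u' = c u1'" "c v' = c v1'"
  shows "L.commute_mod x1 y1"
proof -
  note K = twist_in_colour_group
  have "L.commute_mod x1 y"
    using commute_mod_transfer[OF assms(1,2,4-6)] K assms(3) by blast
  then have "L.commute_mod y x1" using L.commute_mod_sym K assms(3,4) by simp
  then have "L.commute_mod y1 x1"
    using commute_mod_transfer[OF _ assms(3,7-9)] K assms(4) by blast
  then show ?thesis using L.commute_mod_sym K assms(4,7) by simp
qed

lemma twistI:
  assumes "b \<in> carrier B" "1 \<le> i" "i < n" "perm b i = u" "perm b (i + 1) = v"
  shows "twist u v (b \<otimes> sig i [^] strand_exp u v \<otimes> inv b)"
  using assms unfolding twist_def by blast

lemma commuting_conj: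
  assumes "x \<otimes> y = y \<otimes> x" "x \<in> carrier B" "y \<in> carrier B" "b \<in> carrier B"
  shows "(b \<otimes> x \<otimes> inv b) \<otimes> (b \<otimes> y \<otimes> inv b) = (b \<otimes> y \<otimes> inv b) \<otimes> (b \<otimes> x \<otimes> inv b)"
proof -
  have "(b \<otimes> x \<otimes> inv b) \<otimes> (b \<otimes> y \<otimes> inv b) = b \<otimes> (x \<otimes> y) \<otimes> inv b"
    using assms(2-) by (simp add: m_assoc mult_inv_cancel)
  also have "\<dots> = (b \<otimes> y \<otimes> inv b) \<otimes> (b \<otimes> x \<otimes> inv b)"
    unfolding assms(1) using assms(2-) by (simp add: m_assoc mult_inv_cancel)
  finally show ?thesis .
qed

lemma commute_mod_commuting_elements:
  assumes "x \<otimes> y = y \<otimes> x" "x \<in> colour_group" "y \<in> colour_group"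
  shows "L.commute_mod x y"
  using L.commute_mod_commuting[of x y] assms by simp

text \<open>The given twists may run along crossing arcs and fail to commute. A braid bringing the
  four strands to positions 1 to 4 supplies representatives that are conjugates of powers of
  \<open>sig 1\<close> and \<open>sig 3\<close> by the same element.\<close>

lemma commute_mod_disjoint:
  assumes "twist u v x" "twist u' v' y" "distinct [u, v, u', v']"
  shows "L.commute_mod x y"
proof -
  note strands = twist_strands[OF assms(1)] twist_strands[OF assms(2)]
  have sub: "set [u, v, u', v'] \<subseteq> {1..n}" using strands by auto
  have "card (set [u, v, u', v']) \<le> card {1..n}" using sub by (intro card_mono) auto
  then have n: "4 \<le> n" using distinct_card[OF assms(3)] by simp
  obtain b where b: "b \<in> carrier B" "\<And>k. k < length [u, v, u', v'] \<Longrightarrow> perm b (Suc k) = [u, v, u', v'] ! k"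
    using lift_prefix[OF assms(3) sub] by blast
  have s: "sig 1 \<in> carrier B" "sig 3 \<in> carrier B" using n by auto
  let ?x = "b \<otimes> sig 1 [^] strand_exp u v \<otimes> inv b" and ?y = "b \<otimes> sig 3 [^] strand_exp u' v' \<otimes> inv b"
  have t: "twist u v ?x" "twist u' v' ?y"
    using n b(1) b(2)[of 0] b(2)[of 1] b(2)[of 2] b(2)[of 3] by (auto intro!: twistI simp: numeral_3_eq_3)
  have "sig 1 \<otimes> sig 3 = sig 3 \<otimes> sig 1" using far[of 1 3] n by simp
  then have "sig 1 [^] k \<otimes> sig 3 = sig 3 \<otimes> sig 1 [^] k" for k :: nat using intertwine_pow s by metis
  then have "sig 3 [^] l \<otimes> sig 1 [^] k = sig 1 [^] k \<otimes> sig 3 [^] l" for k l :: nat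
    using s by (intro intertwine_pow) auto
  then have "?x \<otimes> ?y = ?y \<otimes> ?x" using s b(1) by (intro commuting_conj) auto
  then have "L.commute_mod ?x ?y" using t twist_in_colour_group by (intro commute_mod_commuting_elements) auto
  then show ?thesis using commute_mod_transfer2[OF _ t assms(1) HOL.refl HOL.refl assms(2) HOL.refl HOL.refl] by blast
qed

lemma twist_exists:
  assumes "u \<noteq> v" "u \<in> {1..n}" "v \<in> {1..n}"
  obtains x where "twist u v x"
proof -
  have "card (set [u, v]) \<le> card {1..n}" using assms by (intro card_mono) auto
  then have n: "2 \<le> n" using assms by simp
  obtain b where b: "b \<in> carrier B" "\<And>k. k < length [u, v] \<Longrightarrow> perm b (Suc k) = [u, v] ! k"
    using lift_prefix[of "[u, v]"] assms by auto
  show ?thesis using that[OF twistI[of b 1 u v]] n b(1) b(2)[of 0] b(2)[of 1] by auto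
qed

definition multiple :: "nat \<Rightarrow> bool" where
  "multiple u \<longleftrightarrow> (\<exists>w \<in> {1..n}. w \<noteq> u \<and> c w = c u)"


text \<open>In the second twist the shared strand is replaced by another one of its colour, which
  makes the twists disjoint. At most one of \<open>v\<close> and \<open>w\<close> has the colour of
  \<open>u\<close>; if one does, it occupies a second strand of the block and \<open>large\<close>
  supplies a third.\<close>

lemma commute_mod_shared_multiple:
  assumes "twist u v x" "twist u w y" "c v \<noteq> c w" "multiple u"
    and large: "\<And>u v. u \<in> {1..n} \<Longrightarrow> v \<in> {1..n} \<Longrightarrow> u \<noteq> v \<Longrightarrow> c u = c v \<Longrightarrow>
      \<exists>w \<in> {1..n}. w \<noteq> u \<and> w \<noteq> v \<and> c w = c u"
  shows "L.commute_mod x y"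
proof -
  note strands = twist_strands[OF assms(1)] twist_strands[OF assms(2)]
  have "\<exists>u' \<in> {1..n}. u' \<noteq> u \<and> u' \<noteq> v \<and> u' \<noteq> w \<and> c u' = c u"
  proof (cases "c v = c u \<or> c w = c u")
    case True
    then show ?thesis using large[of u v] large[of u w] strands assms(3) by metis
  next
    case False
    then show ?thesis using assms(4) unfolding multiple_def by metis
  qed
  then obtain u' where u': "u' \<in> {1..n}" "u' \<noteq> u" "u' \<noteq> v" "u' \<noteq> w" "c u' = c u" by blast
  then have dist: "distinct [u, v, u', w]" using strands assms(3) by auto
  then obtain z where z: "twist u' w z" using twist_exists[OF u'(4,1) strands(6)] by blast
  show ?thesis
    using commute_mod_transfer2[OF commute_mod_disjoint[OF assms(1) z dist] assms(1) z assms(1) _ _ assms(2)] u'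
    by simp
qed

text \<open>The reason is that \<open>\<sigma>\<^sub>1\<^sup>2\<close> commutes with
  \<open>\<sigma>\<^sub>2 \<sigma>\<^sub>1\<^sup>2 \<sigma>\<^sub>2 = (\<sigma>\<^sub>2 \<sigma>\<^sub>1\<^sup>2 \<sigma>\<^sub>2\<^sup>-\<^sup>1) \<sigma>\<^sub>2\<^sup>2\<close>.\<close>

lemma commute_mod_triangle:
  assumes x: "twist u v x" and y: "twist u w y" and "c u \<noteq> c v" "c u \<noteq> c w" "c v \<noteq> c w" "multiple v"
    and large: "\<And>u v. u \<in> {1..n} \<Longrightarrow> v \<in> {1..n} \<Longrightarrow> u \<noteq> v \<Longrightarrow> c u = c v \<Longrightarrow>
      \<exists>w \<in> {1..n}. w \<noteq> u \<and> w \<noteq> v \<and> c w = c u"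
  shows "L.commute_mod x y"
proof -
  note strands = twist_strands[OF x] twist_strands[OF y]
  have sub: "set [u, v, w] \<subseteq> {1..n}" and dist: "distinct [u, v, w]" using strands assms by auto
  have "card (set [u, v, w]) \<le> card {1..n}" using sub by (intro card_mono) auto
  then have n: "3 \<le> n" using distinct_card[OF dist] by simp
  obtain b where b: "b \<in> carrier B" "\<And>k. k < length [u, v, w] \<Longrightarrow> perm b (Suc k) = [u, v, w] ! k"
    using lift_prefix[OF dist sub] by blast
  have pb: "perm b 1 = u" "perm b 2 = v" "perm b 3 = w"
    using b(2)[of 0] b(2)[of 1] b(2)[of 2] by (simp_all add: numeral_3_eq_3 numeral_2_eq_2)
  have s: "sig 1 \<in> carrier B" "sig 2 \<in> carrier B" using n by auto
  \<comment> \<open>\<open>b\<close> brings \<open>u\<close>, \<open>v\<close>, \<open>w\<close> to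
    positions 1, 2, 3. In \<open>?Y\<close> the additional \<open>sig 2\<close> moves
    \<open>w\<close> next to \<open>u\<close>.\<close>
  let ?X = "b \<otimes> sig 1 [^] (2::nat) \<otimes> inv b" and ?Z = "b \<otimes> sig 2 [^] (2::nat) \<otimes> inv b"
    and ?Y = "(b \<otimes> sig 2) \<otimes> sig 1 [^] (2::nat) \<otimes> inv (b \<otimes> sig 2)"
  have X: "twist u v ?X" using twistI[of b 1 u v, unfolded one_add_one] n b(1) pb assms(3) by (simp add: strand_exp_def)
  have Z: "twist v w ?Z" using twistI[of b 2 v w] n b(1) pb assms(5) by (simp add: strand_exp_def)
  have "perm (b \<otimes> sig 2) 1 = u" "perm (b \<otimes> sig 2) 2 = w"
    using n b(1) pb by (simp_all add: perm_mult perm_sig)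
  then have Y: "twist u w ?Y" using twistI[of "b \<otimes> sig 2" 1 u w, unfolded one_add_one] n b(1) s assms(4)
    by (simp add: strand_exp_def)
  have K: "?X \<in> colour_group" "?Y \<in> colour_group" "?Z \<in> colour_group"
    using X Y Z twist_in_colour_group by auto
  let ?yz = "sig 2 \<otimes> sig 1 \<otimes> sig 1 \<otimes> sig 2"
  have YZ: "?Y \<otimes> ?Z = b \<otimes> ?yz \<otimes> inv b"
    using b(1) s by (simp add: inv_mult_group numeral_2_eq_2 m_assoc mult_inv_cancel)
  have br: "sig 1 \<otimes> (sig 2 \<otimes> (sig 1 \<otimes> z)) = sig 2 \<otimes> (sig 1 \<otimes> (sig 2 \<otimes> z))" if "z \<in> carrier B" for z
    using braid[of 1] n s that by (simp add: m_assoc[symmetric] numeral_2_eq_2)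
  have br0: "sig 1 \<otimes> (sig 2 \<otimes> sig 1) = sig 2 \<otimes> (sig 1 \<otimes> sig 2)"
    using br[OF one_closed] s by simp
  have "sig 1 \<otimes> ?yz = sig 2 \<otimes> (sig 1 \<otimes> (sig 2 \<otimes> (sig 1 \<otimes> sig 2)))"
    using s br[of "sig 1 \<otimes> sig 2"] by (simp add: m_assoc)
  also have "\<dots> = ?yz \<otimes> sig 1"
    using s by (simp add: m_assoc br0[symmetric] del: One_nat_def)
  finally have "sig 1 [^] (2::nat) \<otimes> ?yz = ?yz \<otimes> sig 1 [^] (2::nat)"
    using s by (intro intertwine_pow) auto
  then have "?X \<otimes> (?Y \<otimes> ?Z) = (?Y \<otimes> ?Z) \<otimes> ?X"
    unfolding YZ using s b(1) by (intro commuting_conj m_closed nat_pow_closed)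
  moreover have YZK: "?Y \<otimes> ?Z \<in> colour_group" using subgroup.m_closed[OF colour_group_subgroup K(2,3)] .
  ultimately have "L.commute_mod ?X (?Y \<otimes> ?Z)" using K(1) commute_mod_commuting_elements by blast
  \<comment> \<open>\<open>?X\<close> and \<open>?Z\<close> share the strand \<open>v\<close>, which
    is not alone in its colour. Since \<open>?X\<close> also commutes with
    \<open>?Y \<otimes> ?Z\<close>, the factor \<open>?Z\<close> can be divided off.\<close>
  moreover have "L.commute_mod ?X ?Z"
    using commute_mod_shared_multiple[OF twist_commute[OF X] Z assms(4,6) large] by blast
  ultimately have "?Y \<otimes> ?Z \<in> {z \<in> carrier L. L.commute_mod ?X z}" "?Z \<in> {z \<in> carrier L. L.commute_mod ?X z}"
    using K YZK by auto
  moreover have C: "subgroup {z \<in> carrier L. L.commute_mod ?X z} L"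
    using L.commute_mod_subgroup K by simp
  ultimately have "?Y \<otimes> ?Z \<otimes> inv\<^bsub>L\<^esub> ?Z \<in> {z \<in> carrier L. L.commute_mod ?X z}"
    using subgroup.m_closed[OF C] subgroup.m_inv_closed[OF C] by fastforce
  moreover have "?Y \<otimes> ?Z \<otimes> inv\<^bsub>L\<^esub> ?Z = ?Y"
    using K colour_group_subgroup colour_group_subset by (simp add: m_assoc subset_iff)
  ultimately have "L.commute_mod ?X ?Y" by simp
  then show ?thesis using commute_mod_transfer2[OF _ X Y x HOL.refl HOL.refl y HOL.refl HOL.refl] by blast
qed

lemma commute_mod_twists:
  assumes x: "twist u v x" and y: "twist u' v' y"
    and large: "\<And>u v. u \<in> {1..n} \<Longrightarrow> v \<in> {1..n} \<Longrightarrow> u \<noteq> v \<Longrightarrow> c u = c v \<Longrightarrow>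
      \<exists>w \<in> {1..n}. w \<noteq> u \<and> w \<noteq> v \<and> c w = c u"
    and single: "\<And>u v w. u \<in> {1..n} \<Longrightarrow> v \<in> {1..n} \<Longrightarrow> w \<in> {1..n} \<Longrightarrow>
      c u \<noteq> c v \<Longrightarrow> c u \<noteq> c w \<Longrightarrow> c v \<noteq> c w \<Longrightarrow> multiple u \<or> multiple v \<or> multiple w"
  shows "L.commute_mod x y"
proof -
  \<comment> \<open>If \<open>u\<close> is alone in its colour, then three colours occur and
    \<open>single\<close> makes \<open>v\<close> or \<open>w\<close> multiple; the triangle relation
    is applied from that side.\<close>
  have shared: "L.commute_mod x y" if x: "twist u v x" and y: "twist u w y" and vw: "c v \<noteq> c w" for u v w x y
  proof (cases "multiple u")
    case True
    then show ?thesis using commute_mod_shared_multiple[OF x y vw _ large] by blast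
  next
    case False
    note strands = twist_strands[OF x] twist_strands[OF y]
    have ne: "c u \<noteq> c v" "c u \<noteq> c w"
      using False strands unfolding multiple_def by metis+
    then consider "multiple v" | "multiple w" using single[of u v w] strands vw False by blast
    then show ?thesis
    proof cases
      case 1
      then show ?thesis using commute_mod_triangle[OF x y ne vw _ large] by blast
    next
      case 2
      then have "L.commute_mod y x" using commute_mod_triangle[OF y x ne(2,1) vw[symmetric] _ large] by blast
      then show ?thesis using L.commute_mod_sym x y twist_in_colour_group by simp
    qed
  qed
  have same: "L.commute_mod x y"
    if x: "twist u v x" and y: "twist u' v' y" and uu: "c u = c u'" for u v u' v' x y
  proof -
    note strands = twist_strands[OF x] twist_strands[OF y]
    show ?thesis
    proof (cases "c v = c v'")
      case True
      have "L.commute_mod x x" using x twist_in_colour_group by (intro commute_mod_commuting_elements) auto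
      then show ?thesis using commute_mod_transfer2[OF _ x x x HOL.refl HOL.refl y uu True] by blast
    next
      case False
      \<comment> \<open>The strand \<open>v'\<close> may coincide with \<open>u\<close>. Then all of
        \<open>u\<close>, \<open>u'\<close>, \<open>v'\<close> have one colour, and
        \<open>u'\<close> is a substitute for \<open>v'\<close> different from
        \<open>u\<close>.\<close>
      define w where "w = (if v' = u then u' else v')"
      have w: "w \<in> {1..n}" "u \<noteq> w" "c w = c v'" using strands uu by (auto simp: w_def)
      obtain z where z: "twist u w z" using twist_exists[OF w(2) strands(2) w(1)] by blast
      have "L.commute_mod x z" using shared[OF x z] False w by simp
      then show ?thesis
        using commute_mod_transfer2[OF _ x z x HOL.refl HOL.refl y uu w(3)] by blast
    qed
  qed
  note tw = x y twist_commute[OF x] twist_commute[OF y]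
  consider "c u = c u'" | "c u = c v'" | "c v = c u'" | "c v = c v'"
    | "c u \<noteq> c u'" "c u \<noteq> c v'" "c v \<noteq> c u'" "c v \<noteq> c v'" by blast
  then show ?thesis
  proof cases
    case 5
    then have "distinct [u, v, u', v']" using twist_strands[OF x] twist_strands[OF y] by auto
    then show ?thesis using commute_mod_disjoint[OF x y] by blast
  qed (use tw same in blast)+
qed


section \<open>Generation of the colour-preserving braids by twists\<close>

definition twist_group :: "'a set" where
  "twist_group = generate B {x. \<exists>u v. twist u v x}"

lemma twist_set_subset: "{x. \<exists>u v. twist u v x} \<subseteq> colour_group"
  using twist_in_colour_group by auto

lemma twist_group_subgroup: "subgroup twist_group B"
  unfolding twist_group_def
  using twist_set_subset colour_group_subset by (intro generate_is_subgroup) auto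

lemma twist_group_subset: "twist_group \<subseteq> colour_group"
  unfolding twist_group_def by (intro generate_subgroup_incl twist_set_subset colour_group_subgroup)

lemma conj_half_twist_in_twist_group:
  assumes "b \<in> carrier B" "1 \<le> i" "i < n" "c (perm b i) = c (perm b (i + 1))"
  shows "b \<otimes> sig i \<otimes> inv b \<in> twist_group"
  using twistI[OF assms(1-3) HOL.refl HOL.refl] assms
  unfolding twist_group_def strand_exp_def by (intro generate.incl) auto

lemma conj_square_in_twist_group:
  assumes "b \<in> carrier B" "1 \<le> i" "i < n"
  shows "b \<otimes> sig i [^] (2::nat) \<otimes> inv b \<in> twist_group"
proof (cases "c (perm b i) = c (perm b (i + 1))")
  case True
  then have h: "b \<otimes> sig i \<otimes> inv b \<in> twist_group" using conj_half_twist_in_twist_group assms by blast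
  have "b \<otimes> sig i [^] (2::nat) \<otimes> inv b = (b \<otimes> sig i \<otimes> inv b) \<otimes> (b \<otimes> sig i \<otimes> inv b)"
    using assms by (simp add: numeral_2_eq_2 m_assoc mult_inv_cancel)
  then show ?thesis using h twist_group_subgroup by (simp add: subgroup.m_closed)
next
  case False
  then show ?thesis
    using twistI[OF assms HOL.refl HOL.refl]
    unfolding twist_group_def strand_exp_def by (intro generate.incl) auto
qed

text \<open>The braids that can be carried into \<open>twist_group\<close> by sorting their final colours with \<open>m\<close>
  positive generators. By the braid relations the order of the sorting steps is irrelevant.\<close>

primrec sortable :: "nat \<Rightarrow> 'a set" where
  "sortable 0 = twist_group"
| "sortable (Suc m) = {b \<in> carrier B. \<exists>i. 1 \<le> i \<and> i < n \<and>
     c (perm b (i + 1)) < c (perm b i) \<and> b \<otimes> sig i \<in> sortable m}"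

lemma sortable_subset: "sortable m \<subseteq> carrier B"
  by (cases m) (use twist_group_subset colour_group_subset in auto)

lemma sorted_no_descent:
  assumes "b \<in> twist_group" "1 \<le> i" "i < n"
  shows "c (perm b i) \<le> c (perm b (i + 1))"
  using colour_group_colour[of b] twist_group_subset assms colour_mono by auto

lemma perm_mult_sig:
  "b \<in> carrier B \<Longrightarrow> 1 \<le> i \<Longrightarrow> i < n \<Longrightarrow> perm (b \<otimes> sig i) k = perm b (transpose i (i + 1) k)"
  by (simp add: perm_mult perm_sig)

text \<open>Any descent of the final colours may be sorted first, with the same number of steps. By
  induction on \<open>m\<close> the step at \<open>j\<close> is compared with the given first step
  at \<open>i\<close>: they coincide, or commute, or are neighbours, and the braid relation closes
  the diamond.\<close>

lemma sortable_descent: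
  assumes "b \<in> sortable m" "1 \<le> j" "j < n" "c (perm b (j + 1)) < c (perm b j)"
  obtains k where "m = Suc k" "b \<otimes> sig j \<in> sortable k"
proof -
  have "\<exists>k. m = Suc k \<and> b \<otimes> sig j \<in> sortable k"
    using assms
  proof (induction m arbitrary: b j rule: less_induct)
    case (less m)
    show ?case
    proof (cases m)
      case 0
      then show ?thesis using less.prems sorted_no_descent[of b j] by simp
    next
      case (Suc k)
      then obtain i where i: "b \<in> carrier B" "1 \<le> i" "i < n" "c (perm b (i + 1)) < c (perm b i)"
        "b \<otimes> sig i \<in> sortable k" using less.prems by auto
      have s: "sig i \<in> carrier B" "sig j \<in> carrier B" using i less.prems by auto
      note p = perm_mult_sig[OF i(1-3)] and pj = perm_mult_sig[OF i(1) less.prems(2,3)]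
      have step: "d \<in> sortable (Suc l)"
        if "d \<in> carrier B" "1 \<le> a" "a < n" "c (perm d (a + 1)) < c (perm d a)" "d \<otimes> sig a \<in> sortable l"
        for d a l using that by auto
      consider "i = j" | "i + 2 \<le> j \<or> j + 2 \<le> i" | "j = i + 1" | "i = j + 1" by linarith
      then show ?thesis
      proof cases
        case 1
        then show ?thesis using i Suc by auto
      next
        case 2
        have "c (perm (b \<otimes> sig i) (j + 1)) < c (perm (b \<otimes> sig i) j)"
          using less.prems(4) 2 by (auto simp: p)
        then obtain l where l: "k = Suc l" "b \<otimes> sig i \<otimes> sig j \<in> sortable l"
          using less.IH[of k "b \<otimes> sig i" j] i less.prems Suc by auto
        have "sig i \<otimes> sig j = sig j \<otimes> sig i" using far[of i j] far[of j i] 2 i less.prems by auto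
        then have "b \<otimes> sig i \<otimes> sig j = b \<otimes> sig j \<otimes> sig i" using s i(1) by (simp add: m_assoc)
        moreover have "c (perm (b \<otimes> sig j) (i + 1)) < c (perm (b \<otimes> sig j) i)"
          using i(4) 2 by (auto simp: pj)
        ultimately have "b \<otimes> sig j \<in> sortable (Suc l)"
          using l i s by (intro step[of _ i]) auto
        then show ?thesis using l Suc by auto
      next
        \<comment> \<open>The colours at \<open>i\<close>, \<open>i + 1\<close>,
          \<open>i + 2\<close> strictly decrease, so all steps of \<open>i\<close>,
          \<open>i + 1\<close>, \<open>i\<close> and of \<open>i + 1\<close>, \<open>i\<close>,
          \<open>i + 1\<close> are descents; both lead to the same braid. The last case is the
          mirror image.\<close>
        case 3
        have n: "i + 1 < n" using 3 less.prems by simp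
        have bi: "b \<otimes> sig i \<in> carrier B" using i s by simp
        have "c (perm (b \<otimes> sig i) (i + 1 + 1)) < c (perm (b \<otimes> sig i) (i + 1))"
          using i(1-4) less.prems(4) 3 by (simp add: p)
        then obtain l where l: "k = Suc l" "b \<otimes> sig i \<otimes> sig (i + 1) \<in> sortable l"
          using less.IH[of k "b \<otimes> sig i" "i + 1"] i n Suc by auto
        have "c (perm (b \<otimes> sig i \<otimes> sig (i + 1)) (i + 1)) < c (perm (b \<otimes> sig i \<otimes> sig (i + 1)) i)"
          using i(1-4) less.prems(4) 3 n bi by (simp add: perm_mult_sig p pj)
        then obtain q where q: "l = Suc q" "b \<otimes> sig i \<otimes> sig (i + 1) \<otimes> sig i \<in> sortable q"
          using less.IH[of l "b \<otimes> sig i \<otimes> sig (i + 1)" i] i l Suc by auto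
        have "b \<otimes> sig i \<otimes> sig (i + 1) \<otimes> sig i = b \<otimes> (sig i \<otimes> sig (i + 1) \<otimes> sig i)"
          using i(1) s 3 by (simp add: m_assoc)
        also have "\<dots> = b \<otimes> sig j \<otimes> sig i \<otimes> sig j"
          unfolding braid[OF i(2) n] using i(1) s 3 by (simp add: m_assoc)
        finally have 1: "b \<otimes> sig j \<otimes> sig i \<otimes> sig j \<in> sortable q" using q by simp
        have bj: "b \<otimes> sig j \<in> carrier B" "b \<otimes> sig j \<otimes> sig i \<in> carrier B" using i s by auto
        have "c (perm (b \<otimes> sig j \<otimes> sig i) (j + 1)) < c (perm (b \<otimes> sig j \<otimes> sig i) j)"
          using i(1-4) less.prems(4) 3 n bj less.prems(2,3) by (simp add: perm_mult_sig p pj)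
        then have 2: "b \<otimes> sig j \<otimes> sig i \<in> sortable (Suc q)" using step[OF bj(2) less.prems(2,3) _ 1] by blast
        have "c (perm (b \<otimes> sig j) (i + 1)) < c (perm (b \<otimes> sig j) i)"
          using i(1-4) less.prems(4) 3 n less.prems(2,3) by (simp add: perm_mult_sig p pj)
        then have "b \<otimes> sig j \<in> sortable (Suc (Suc q))" using step[OF bj(1) i(2,3) _ 2] by blast
        then show ?thesis using l q Suc by auto
      next
        case 4
        have n: "j + 1 < n" using 4 i by simp
        have bi: "b \<otimes> sig i \<in> carrier B" using i s by simp
        have "c (perm (b \<otimes> sig i) (j + 1)) < c (perm (b \<otimes> sig i) j)"
          using i(1-4) less.prems(2-4) 4 by (simp add: perm_mult_sig)
        then obtain l where l: "k = Suc l" "b \<otimes> sig i \<otimes> sig j \<in> sortable l"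
          using less.IH[of k "b \<otimes> sig i" j] i n less.prems Suc by auto
        have "c (perm (b \<otimes> sig i \<otimes> sig j) (i + 1)) < c (perm (b \<otimes> sig i \<otimes> sig j) i)"
          using i(1-4) less.prems 4 n bi by (simp add: perm_mult_sig p pj)
        then obtain q where q: "l = Suc q" "b \<otimes> sig i \<otimes> sig j \<otimes> sig i \<in> sortable q"
          using less.IH[of l "b \<otimes> sig i \<otimes> sig j" i] i l Suc by auto
        have "b \<otimes> sig i \<otimes> sig j \<otimes> sig i = b \<otimes> (sig (j + 1) \<otimes> sig j \<otimes> sig (j + 1))"
          using i(1) s 4 by (simp add: m_assoc)
        also have "\<dots> = b \<otimes> sig j \<otimes> sig i \<otimes> sig j"
          unfolding braid[OF less.prems(2) n, symmetric] using i(1) s 4 by (simp add: m_assoc)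
        finally have 1: "b \<otimes> sig j \<otimes> sig i \<otimes> sig j \<in> sortable q" using q by simp
        have bj: "b \<otimes> sig j \<in> carrier B" "b \<otimes> sig j \<otimes> sig i \<in> carrier B" using i s by auto
        have "c (perm (b \<otimes> sig j \<otimes> sig i) (j + 1)) < c (perm (b \<otimes> sig j \<otimes> sig i) j)"
          using i(1-4) less.prems(4) 4 n bi bj less.prems(2,3) by (simp add: perm_mult_sig p pj)
        then have 2: "b \<otimes> sig j \<otimes> sig i \<in> sortable (Suc q)" using step[OF bj(2) less.prems(2,3) _ 1] by blast
        have "c (perm (b \<otimes> sig j) (i + 1)) < c (perm (b \<otimes> sig j) i)"
          using i(1-4) less.prems(4) 4 n less.prems(2,3) by (simp add: perm_mult_sig p pj)
        then have "b \<otimes> sig j \<in> sortable (Suc (Suc q))" using step[OF bj(1) i(2,3) _ 2] by blast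
        then show ?thesis using l q Suc by auto
      qed
    qed
  qed
  then show ?thesis using that by blast
qed

text \<open>A left factor that preserves colours does not change the final colours, so the same
  sorting steps apply.\<close>

lemma sortable_left_mult:
  assumes "h \<in> twist_group" "b \<in> sortable m"
  shows "h \<otimes> b \<in> sortable m"
  using assms(2)
proof (induction m arbitrary: b)
  case 0
  then show ?case using assms(1) twist_group_subgroup by (simp add: subgroup.m_closed)
next
  case (Suc m)
  have h: "h \<in> colour_group" "h \<in> carrier B" using assms(1) twist_group_subset colour_group_subset by auto
  obtain i where i: "b \<in> carrier B" "1 \<le> i" "i < n" "c (perm b (i + 1)) < c (perm b i)"
    "b \<otimes> sig i \<in> sortable m" using Suc.prems by auto
  have "h \<otimes> b \<otimes> sig i \<in> sortable m" using Suc.IH[OF i(5)] h i by (simp add: m_assoc)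
  then show ?case using i h by (auto simp: perm_mult colour_group_colour)
qed

text \<open>At a descent \<open>sig i\<close> is itself a sorting step. At an ascent
  \<open>b \<otimes> sig i\<close> is one step away from
  \<open>b \<otimes> sig i \<otimes> sig i\<close>, a full twist times \<open>b\<close>. For equal
  colours \<open>b \<otimes> sig i\<close> is a half twist times \<open>b\<close>.\<close>

lemma sortable_right_mult:
  assumes "b \<in> sortable m" "1 \<le> i" "i < n"
  shows "\<exists>m. b \<otimes> sig i \<in> sortable m"
proof -
  have b: "b \<in> carrier B" using assms sortable_subset by blast
  have s: "sig i \<in> carrier B" using assms by simp
  consider "c (perm b (i + 1)) < c (perm b i)" | "c (perm b i) < c (perm b (i + 1))"
    | "c (perm b i) = c (perm b (i + 1))" by linarith
  then show ?thesis
  proof cases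
    case 1
    then show ?thesis using sortable_descent[OF assms] by blast
  next
    case 2
    have "b \<otimes> sig i [^] (2::nat) \<otimes> inv b \<otimes> b \<in> sortable m"
      using sortable_left_mult[OF conj_square_in_twist_group[OF b assms(2,3)] assms(1)] .
    then have "b \<otimes> sig i \<otimes> sig i \<in> sortable m" using b s by (simp add: m_assoc numeral_2_eq_2)
    then have "b \<otimes> sig i \<in> sortable (Suc m)"
      using 2 b s assms by (auto simp: perm_mult_sig intro!: exI[of _ i])
    then show ?thesis by blast
  next
    case 3
    have "b \<otimes> sig i \<otimes> inv b \<otimes> b \<in> sortable m"
      using sortable_left_mult[OF conj_half_twist_in_twist_group[OF b assms(2,3) 3] assms(1)] .
    then show ?thesis using b s by (auto simp: m_assoc)
  qed
qed

lemma sortable_right_mult_inv: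
  assumes "b \<in> sortable m" "1 \<le> i" "i < n"
  shows "\<exists>m. b \<otimes> inv (sig i) \<in> sortable m"
proof -
  have b: "b \<in> carrier B" using assms sortable_subset by blast
  have s: "sig i \<in> carrier B" using assms by simp
  obtain l where l: "b \<otimes> sig i \<in> sortable l" using sortable_right_mult[OF assms] by blast
  \<comment> \<open>\<open>b \<otimes> inv (sig i)\<close> is the inverse of this full twist times
    \<open>b \<otimes> sig i\<close>.\<close>
  have "inv (b \<otimes> sig i [^] (2::nat) \<otimes> inv b) \<in> twist_group"
    using conj_square_in_twist_group[OF b assms(2,3)] twist_group_subgroup by (simp add: subgroup.m_inv_closed)
  from sortable_left_mult[OF this l] show ?thesis
    using b s by (auto simp: m_assoc inv_mult_group numeral_2_eq_2 mult_inv_cancel)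
qed

lemma all_sortable:
  assumes "b \<in> carrier B"
  shows "\<exists>m. b \<in> sortable m"
proof -
  \<comment> \<open>Stated for an arbitrary sortable left factor, so that the induction passes
    through products.\<close>
  have right: "\<exists>m. a \<otimes> x \<in> sortable m" if "x \<in> generate B (sig ` {1..<n})" "a \<in> sortable k" for x a k
    using that
  proof (induction x arbitrary: a k rule: generate.induct)
    case one
    then show ?case using sortable_subset by fastforce
  next
    case (incl h)
    then show ?case using sortable_right_mult by auto
  next
    case (inv h)
    then show ?case using sortable_right_mult_inv by auto
  next
    case (eng h1 h2)
    have "h1 \<in> carrier B" "h2 \<in> carrier B" "a \<in> carrier B"
      using eng.hyps gen eng.prems sortable_subset by auto
    then show ?case using eng.IH eng.prems by (metis m_assoc)
  qed
  have "\<one> \<in> sortable 0" using twist_group_subgroup by (simp add: subgroup.one_closed)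
  then have "\<exists>m. \<one> \<otimes> b \<in> sortable m" using right assms unfolding gen by blast
  then show ?thesis using assms by simp
qed

text \<open>A colour-preserving braid ends with its colours in order. It has no descent with which a
  sorting could begin, so it is sortable only in zero steps.\<close>

lemma colour_group_eq_twist_group: "colour_group = twist_group"
proof
  show "colour_group \<subseteq> twist_group"
  proof
    fix x assume x: "x \<in> colour_group"
    then obtain m where m: "x \<in> sortable m" using all_sortable colour_group_subset by blast
    have "\<not> c (perm x (i + 1)) < c (perm x i)" if "1 \<le> i" "i < n" for i
      using colour_mono[OF that] colour_group_colour[OF x] by simp
    then have "m = 0" using m by (cases m) auto
    then show "x \<in> twist_group" using m by simp
  qed
qed (rule twist_group_subset)

lemma lower_central_2_eq_3:
  assumes "\<And>u v. u \<in> {1..n} \<Longrightarrow> v \<in> {1..n} \<Longrightarrow> u \<noteq> v \<Longrightarrow> c u = c v \<Longrightarrow>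
      \<exists>w \<in> {1..n}. w \<noteq> u \<and> w \<noteq> v \<and> c w = c u"
    and "\<And>u v w. u \<in> {1..n} \<Longrightarrow> v \<in> {1..n} \<Longrightarrow> w \<in> {1..n} \<Longrightarrow>
      c u \<noteq> c v \<Longrightarrow> c u \<noteq> c w \<Longrightarrow> c v \<noteq> c w \<Longrightarrow> multiple u \<or> multiple v \<or> multiple w"
  shows "lower_central L 2 = lower_central L 3"
proof (rule L.lower_central_2_eq_3I)
  show "carrier L = generate L {x. \<exists>u v. twist u v x}"
    using colour_group_eq_twist_group generate_consistent[OF twist_set_subset colour_group_subgroup]
    by (simp add: twist_group_def)
  show "{x. \<exists>u v. twist u v x} \<subseteq> carrier L" using twist_set_subset by simp
  show "L.commute_mod x y" if "x \<in> {x. \<exists>u v. twist u v x}" "y \<in> {x. \<exists>u v. twist u v x}" for x y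
    using that commute_mod_twists assms by blast
qed

end

section \<open>Dihedral quotients\<close>

abbreviation (input) affine :: "(int \<Rightarrow> int) \<Rightarrow> bool" where
  "affine f \<equiv> \<exists>e a. (e = 1 \<or> e = -1) \<and> f = (\<lambda>k. e * k + a)"

lemma affine_comp: "affine f \<Longrightarrow> affine g \<Longrightarrow> affine (f \<circ> g)"
proof -
  assume "affine f" "affine g"
  then obtain e a e' a' where "e = 1 \<or> e = -1" "f = (\<lambda>k. e * k + a)"
    and "e' = 1 \<or> e' = -1" "g = (\<lambda>k. e' * k + a')" by blast
  then show ?thesis
    by (intro exI[of _ "e * e'"] exI[of _ "e * a' + a"]) (auto simp: fun_eq_iff algebra_simps)
qed

lemma affine_inverse:
  assumes "e = 1 \<or> e = -1" "f = (\<lambda>k. e * k + a)"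
  shows "bij f" "inv' f = (\<lambda>k::int. e * k + (- e * a))"
proof -
  have e: "e * e = 1" using assms(1) by auto
  have ee: "e * (e * x) = x" for x using e by (simp add: mult.assoc[symmetric])
  have 1: "f \<circ> (\<lambda>k. e * k + (- e * a)) = id" "(\<lambda>k. e * k + (- e * a)) \<circ> f = id"
    unfolding assms(2) by (simp_all add: fun_eq_iff distrib_left right_diff_distrib ee)
  then show "bij f" by (metis o_bij)
  show "inv' f = (\<lambda>k. e * k + (- e * a))" using 1 by (metis inv_unique_comp)
qed

text \<open>Letters act on colourings of the positions; the values of \<open>step\<close> form a functor from the
  groupoid of colourings to the infinite dihedral group.\<close>

locale braid_cocycle =
  fixes step :: "(nat \<Rightarrow> nat) \<Rightarrow> nat \<Rightarrow> int \<Rightarrow> int" and V :: "(nat \<Rightarrow> nat) set"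
  assumes closed: "c \<in> V \<Longrightarrow> c \<circ> transpose i (i + 1) \<in> V"
    and step_affine: "c \<in> V \<Longrightarrow> affine (step c i)"
    and step_far: "c \<in> V \<Longrightarrow> i + 2 \<le> j \<Longrightarrow>
      step c i \<circ> step (c \<circ> transpose i (i + 1)) j = step c j \<circ> step (c \<circ> transpose j (j + 1)) i"
    and step_braid: "c \<in> V \<Longrightarrow>
      step c i \<circ> step (c \<circ> transpose i (i + 1)) (i + 1) \<circ>
        step (c \<circ> transpose i (i + 1) \<circ> transpose (i + 1) (i + 2)) i =
      step c (i + 1) \<circ> step (c \<circ> transpose (i + 1) (i + 2)) i \<circ>
        step (c \<circ> transpose (i + 1) (i + 2) \<circ> transpose i (i + 1)) (i + 1)"
begin

text \<open>An inverse letter runs through an arrow of the groupoid backwards; it receives the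
  inverse of the step at the colouring to which it leads.\<close>

fun val :: "(nat \<Rightarrow> nat) \<Rightarrow> nat letter list \<Rightarrow> int \<Rightarrow> int" where
  "val c [] = id"
| "val c ((i, b) # w) =
     (if b then step c i else inv' (step (c \<circ> transpose i (i + 1)) i)) \<circ> val (c \<circ> transpose i (i + 1)) w"

lemma step_bij: "c \<in> V \<Longrightarrow> bij (step c i)"
  using step_affine affine_inverse(1) by blast

lemma val_append: "val c (u @ v) = val c u \<circ> val (c \<circ> word_perm u) v"
  by (induction u arbitrary: c) (auto simp: comp_assoc)

lemma word_perm_closed: "c \<in> V \<Longrightarrow> c \<circ> word_perm w \<in> V"
proof (induction w arbitrary: c)
  case (Cons a w)
  obtain i b where a: "a = (i, b)" by force
  show ?case
    using Cons.IH[OF closed[OF Cons.prems, of i]] by (simp only: a word_perm_simps comp_assoc)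
qed simp

lemma val_affine: "c \<in> V \<Longrightarrow> affine (val c w)"
proof (induction w arbitrary: c)
  case Nil
  show ?case by (intro exI[of _ 1] exI[of _ 0]) (auto simp: fun_eq_iff)
next
  case (Cons a w)
  obtain i b where a: "a = (i, b)" by force
  let ?c = "c \<circ> transpose i (i + 1)"
  have "affine (inv' (step ?c i))"
    using step_affine[OF closed[OF Cons.prems], of i i] affine_inverse(2) by blast
  then have "affine (if b then step c i else inv' (step ?c i))"
    using step_affine[OF Cons.prems, of i] by (cases b) simp_all
  then show ?case
    unfolding a val.simps using Cons.IH[OF closed[OF Cons.prems]] by (rule affine_comp)
qed

lemma val_pres_eq:
  "pres_eq {1..<n} (braid_relations n) u v \<Longrightarrow> c \<in> V \<Longrightarrow> val c u = val c v"
proof (induction arbitrary: c rule: pres_eq.induct)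
  case (cancel u v x b)
  let ?d = "c \<circ> word_perm u"
  have d: "?d \<in> V" using word_perm_closed cancel by blast
  have "val ?d [(x, b), (x, \<not> b)] = id"
    using step_bij[OF d, of x] step_bij[OF closed[OF d], of x x]
    by (cases b) (simp_all add: comp_assoc bij_is_surj surj_iff[symmetric] bij_is_inj inj_iff[symmetric])
  then show ?case unfolding val_append by (simp add: comp_assoc del: val.simps)
next
  case (rel u v r s)
  let ?d = "c \<circ> word_perm u"
  have d: "?d \<in> V" using word_perm_closed rel by blast
  have "word_perm r = word_perm s"
    using pres_eq.rel[of "[]" "{1..<n}" "[]" r s "braid_relations n"] rel word_perm_cong[of n r s] by simp
  moreover have "val ?d r = val ?d s"
    using rel(3) step_far[OF d] step_braid[OF d] by (auto simp: braid_relations_def comp_assoc)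
  ultimately show ?case unfolding val_append by simp
qed auto

abbreviation (input) braid_class :: "nat \<Rightarrow> nat letter list \<Rightarrow> nat letter list set" where
  "braid_class n w \<equiv> pres_rel {1..<n} (braid_relations n) `` {w}"

definition class_val :: "(nat \<Rightarrow> nat) \<Rightarrow> nat letter list set \<Rightarrow> int \<Rightarrow> int" where
  "class_val c X = val c (SOME w. w \<in> X)"

lemma class_val_class:
  assumes "w \<in> words {1..<n}" "c \<in> V"
  shows "class_val c (braid_class n w) = val c w"
proof -
  have "w \<in> braid_class n w" using assms by (auto simp: pres_rel_def intro: pres_eq.refl)
  then have "(SOME v. v \<in> braid_class n w) \<in> braid_class n w" by (rule someI)
  then show ?thesis
    unfolding class_val_def using val_pres_eq[OF _ assms(2)] by (simp add: pres_rel_def)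
qed

text \<open>Words with permutation in the Young subgroup are loops at \<open>c\<close> in the
  groupoid, and on loops the functor is a homomorphism.\<close>

lemma not_lcs_stops_cocycle:
  fixes lam
  defines "n \<equiv> sum_list lam"
  assumes c: "c \<in> V" and inv: "\<And>p. p \<in> young_subgroup lam \<Longrightarrow> c \<circ> p = c"
    and s: "s \<in> words {1..<n}" "word_perm s \<in> young_subgroup lam" "val c s = (\<lambda>k. - k + a)"
    and t: "t \<in> words {1..<n}" "word_perm t \<in> young_subgroup lam" "val c t = (\<lambda>k. k + b)" "b \<noteq> 0"
  shows "\<not> lcs_stops (partitioned_braid_group lam)"
proof -
  let ?G = "partitioned_braid_group lam"
  interpret G: group ?G by (rule group_partitioned_braid_group)
  have carrier: "X \<in> carrier ?G \<longleftrightarrow> (\<exists>w \<in> words {1..<n}. X = braid_class n w \<and> word_perm w \<in> young_subgroup lam)" for X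
    by (auto simp: partitioned_braid_group_def braid_group_def presented_group_carrier n_def braid_perm_class
        simp del: One_nat_def)
  show ?thesis
  proof (rule G.not_lcs_stops_dihedral)
    fix X Y assume "X \<in> carrier ?G" "Y \<in> carrier ?G"
    then obtain u v where u: "u \<in> words {1..<n}" "X = braid_class n u" "word_perm u \<in> young_subgroup lam"
      and v: "v \<in> words {1..<n}" "Y = braid_class n v" unfolding carrier by blast
    have "X \<otimes>\<^bsub>?G\<^esub> Y = braid_class n (u @ v)"
      using presented_group_mult[of u "{1..<n}" v] u v
      by (simp add: partitioned_braid_group_def braid_group_def n_def)
    then show "class_val c (X \<otimes>\<^bsub>?G\<^esub> Y) = class_val c X \<circ> class_val c Y"
      using u v c inv[OF u(3)] by (simp add: class_val_class val_append del: One_nat_def)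
  next
    fix X assume "X \<in> carrier ?G"
    then show "affine (class_val c X)"
      unfolding carrier using val_affine[OF c] c by (auto simp: class_val_class simp del: One_nat_def)
  next
    show "braid_class n s \<in> carrier ?G" "braid_class n t \<in> carrier ?G" unfolding carrier using s t by blast+
    show "class_val c (braid_class n s) = (\<lambda>k. - k + a)" "class_val c (braid_class n t) = (\<lambda>k. k + b)"
      using s t c by (simp_all add: class_val_class del: One_nat_def)
  qed (rule t)
qed

end

text \<open>Two red strands (colour 1): the dihedral group records their transposition and the difference
  of their linking numbers with the remaining strands.\<close>

definition two_red_step :: "(nat \<Rightarrow> nat) \<Rightarrow> nat \<Rightarrow> int \<Rightarrow> int" where
  "two_red_step c i =
     (if c i = 1 \<and> c (i + 1) = 1 then uminus
      else if c i = 1 \<or> c (i + 1) = 1 then (if \<exists>k < i. c k = 1 then (\<lambda>x. x - 1) else (\<lambda>x. x + 1))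
      else id)"

definition reds :: "(nat \<Rightarrow> nat) \<Rightarrow> nat \<Rightarrow> nat \<Rightarrow> bool" where
  "reds c a b \<longleftrightarrow> a < b \<and> (\<forall>k. c k = 1 \<longleftrightarrow> k = a \<or> k = b)"

lemma two_red_step_eq:
  assumes "reds c a b"
  shows "two_red_step c i =
    (if i = a \<and> b = i + 1 then uminus else if i = a \<or> i + 1 = a then (\<lambda>x. x + 1)
     else if i = b \<or> i + 1 = b then (\<lambda>x. x - 1) else id)"
proof -
  have less: "a < b" and c: "c k = 1 \<longleftrightarrow> k = a \<or> k = b" for k
    using assms unfolding reds_def by blast+
  have "(\<exists>k < i. k = a \<or> k = b) \<longleftrightarrow> a < i" using less by auto
  then show ?thesis using less unfolding two_red_step_def c by auto
qed

text \<open>The positions are recorded in increasing order, so a crossing of the two red strands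
  with each other leaves the pair unchanged.\<close>

lemma reds_transpose:
  assumes "reds c a b"
  shows "reds (c \<circ> transpose i (i + 1))
    (if i = a \<and> b = i + 1 then a else transpose i (i + 1) a) (if i = a \<and> b = i + 1 then b else transpose i (i + 1) b)"
proof -
  have "transpose i (i + 1) k = x \<longleftrightarrow> k = transpose i (i + 1) x" for k x
    by (metis transpose_involutory)
  then have "(c \<circ> transpose i (i + 1)) k = 1 \<longleftrightarrow> k = transpose i (i + 1) a \<or> k = transpose i (i + 1) b" for k
    using assms by (simp add: reds_def)
  moreover have "\<not> (i = a \<and> b = i + 1) \<Longrightarrow> transpose i (i + 1) a < transpose i (i + 1) b"
    using assms by (auto simp: reds_def transpose_def)
  ultimately show ?thesis using assms by (auto simp: reds_def)
qed

text \<open>With two red strands the braid relation holds because the first and the second one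
  contribute opposite translations and \<open>uminus\<close> inverts translations. The proof is a
  finite check on the positions of \<open>a\<close> and \<open>b\<close> relative to
  \<open>i\<close>.\<close>

interpretation two_red: braid_cocycle two_red_step "{c. \<exists>a b. reds c a b}"
proof
  fix c :: "nat \<Rightarrow> nat" and i j assume "c \<in> {c. \<exists>a b. reds c a b}"
  then obtain a b where ab: "reds c a b" by blast
  then have less: "a < b" by (simp add: reds_def)
  show "c \<circ> transpose i (i + 1) \<in> {c. \<exists>a b. reds c a b}" using reds_transpose[OF ab] by blast
  show "affine (two_red_step c i)"
    unfolding two_red_step_def
    by (auto simp: fun_eq_iff intro: exI[of _ "1::int"] exI[of _ "-1::int"])
  note t = reds_transpose[OF ab, of i] reds_transpose[OF ab, of j] reds_transpose[OF ab, of "i + 1"]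
  note e = two_red_step_eq[OF ab] t[THEN two_red_step_eq]
  show "two_red_step c i \<circ> two_red_step (c \<circ> transpose i (i + 1)) j =
      two_red_step c j \<circ> two_red_step (c \<circ> transpose j (j + 1)) i" if "i + 2 \<le> j"
    unfolding e using that less by (auto simp: transpose_def fun_eq_iff)
  note tt = reds_transpose[OF t(1), of "i + 1"] reds_transpose[OF t(3), of i]
  show "two_red_step c i \<circ> two_red_step (c \<circ> transpose i (i + 1)) (i + 1) \<circ>
        two_red_step (c \<circ> transpose i (i + 1) \<circ> transpose (i + 1) (i + 2)) i =
      two_red_step c (i + 1) \<circ> two_red_step (c \<circ> transpose (i + 1) (i + 2)) i \<circ>
        two_red_step (c \<circ> transpose (i + 1) (i + 2) \<circ> transpose i (i + 1)) (i + 1)"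
  proof -
    have i2: "i + 2 = i + 1 + 1" by simp
    have cases: "x < i \<or> x = i \<or> x = i + 1 \<or> x = i + 1 + 1 \<or> i + 1 + 1 < x" for x by linarith
    show ?thesis
      unfolding i2 e tt[THEN two_red_step_eq]
      using cases[of a] cases[of b] less
      by (elim disjE; simp add: transpose_def fun_eq_iff)
  qed
qed

text \<open>Three strands of colours 1, 2, 3: the quotient of the pure braid group on three strands by its
  centre is free on \<open>A\<^sub>1\<^sub>2\<close> and \<open>A\<^sub>2\<^sub>3\<close>, which are sent to two reflections. Only
  crossings that restore the order of the two colours carry a value.\<close>

definition three_strand_step :: "(nat \<Rightarrow> nat) \<Rightarrow> nat \<Rightarrow> int \<Rightarrow> int" where
  "three_strand_step c i =
     (if c i = 2 \<and> c (i + 1) = 1 then uminus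
      else if c i = 3 \<and> c (i + 1) = 2 then (\<lambda>x. 1 - x)
      else if c i = 3 \<and> c (i + 1) = 1 then (if \<exists>k > i. c k = 2 then (\<lambda>x. x - 1) else (\<lambda>x. x + 1))
      else id)"

definition marked :: "(nat \<Rightarrow> nat) \<Rightarrow> nat \<Rightarrow> nat \<Rightarrow> nat \<Rightarrow> bool" where
  "marked c p q r \<longleftrightarrow> p \<noteq> q \<and> p \<noteq> r \<and> q \<noteq> r \<and>
     (\<forall>k. (c k = 1 \<longleftrightarrow> k = p) \<and> (c k = 2 \<longleftrightarrow> k = q) \<and> (c k = 3 \<longleftrightarrow> k = r))"

lemma three_strand_step_eq:
  assumes "marked c p q r"
  shows "three_strand_step c i =
    (if i = q \<and> i + 1 = p then uminus else if i = r \<and> i + 1 = q then (\<lambda>x. 1 - x)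
     else if i = r \<and> i + 1 = p then (if i < q then (\<lambda>x. x - 1) else (\<lambda>x. x + 1)) else id)"
proof -
  have c: "c k = 1 \<longleftrightarrow> k = p" "c k = 2 \<longleftrightarrow> k = q" "c k = 3 \<longleftrightarrow> k = r" for k
    using assms unfolding marked_def by blast+
  have "(\<exists>k > i. k = q) \<longleftrightarrow> i < q" by auto
  then show ?thesis unfolding three_strand_step_def c by presburger
qed

lemma marked_transpose:
  assumes "marked c p q r"
  shows "marked (c \<circ> transpose i (i + 1)) (transpose i (i + 1) p) (transpose i (i + 1) q) (transpose i (i + 1) r)"
proof -
  have t: "transpose i (i + 1) k = x \<longleftrightarrow> k = transpose i (i + 1) x" for k x
    by (metis transpose_involutory)
  have c: "c k = 1 \<longleftrightarrow> k = p" "c k = 2 \<longleftrightarrow> k = q" "c k = 3 \<longleftrightarrow> k = r" for k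
    using assms unfolding marked_def by blast+
  have "p \<noteq> q" "p \<noteq> r" "q \<noteq> r" using assms unfolding marked_def by blast+
  then have "transpose i (i + 1) p \<noteq> transpose i (i + 1) q" "transpose i (i + 1) p \<noteq> transpose i (i + 1) r"
    "transpose i (i + 1) q \<noteq> transpose i (i + 1) r" by (metis transpose_involutory)+
  then show ?thesis unfolding marked_def comp_apply c t by blast
qed

text \<open>The values of the crossings of colours 3 and 1 are dictated by the braid relation on the
  colours 3, 2, 1: they make the half twist that restores the order 1, 2, 3 trivial along both
  factorisations. This agrees with killing the centre.\<close>

interpretation three_strand: braid_cocycle three_strand_step "{c. \<exists>p q r. marked c p q r}"
proof
  fix c :: "nat \<Rightarrow> nat" and i j assume "c \<in> {c. \<exists>p q r. marked c p q r}"
  then obtain p q r where pqr: "marked c p q r" by blast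
  then have ne: "p \<noteq> q" "p \<noteq> r" "q \<noteq> r" by (simp_all add: marked_def)
  show "c \<circ> transpose i (i + 1) \<in> {c. \<exists>p q r. marked c p q r}" using marked_transpose[OF pqr] by blast
  show "affine (three_strand_step c i)"
    unfolding three_strand_step_def
    by (auto simp: fun_eq_iff intro: exI[of _ "1::int"] exI[of _ "-1::int"])
  note t = marked_transpose[OF pqr, of i] marked_transpose[OF pqr, of j] marked_transpose[OF pqr, of "i + 1"]
  note e = three_strand_step_eq[OF pqr] t[THEN three_strand_step_eq]
  show "three_strand_step c i \<circ> three_strand_step (c \<circ> transpose i (i + 1)) j =
      three_strand_step c j \<circ> three_strand_step (c \<circ> transpose j (j + 1)) i" if far: "i + 2 \<le> j"
  proof -
    have fixed: "transpose i (i + 1) k = k" if "j \<le> k" for k using that far by simp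
    have "(\<exists>k > j. c (transpose i (i + 1) k) = 2) \<longleftrightarrow> (\<exists>k > j. c k = 2)"
      using fixed by (metis less_imp_le)
    then have 1: "three_strand_step (c \<circ> transpose i (i + 1)) j = three_strand_step c j"
      unfolding three_strand_step_def comp_apply using fixed[of j] fixed[of "j + 1"] by simp
    have "i < transpose j (j + 1) k \<longleftrightarrow> i < k" for k using far by (auto simp: transpose_def)
    then have "(\<exists>k > i. c (transpose j (j + 1) k) = 2) \<longleftrightarrow> (\<exists>k > i. c k = 2)"
      by (metis transpose_involutory)
    then have 2: "three_strand_step (c \<circ> transpose j (j + 1)) i = three_strand_step c i"
      unfolding three_strand_step_def comp_apply using far by simp
    \<comment> \<open>A nontrivial step involves two marked strands, and three strands cannot serve
      two disjoint crossings.\<close>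
    have 3: "three_strand_step c i = id \<or> three_strand_step c j = id"
      unfolding e using far by auto
    show ?thesis unfolding 1 2 using 3 by auto
  qed
  note tt = marked_transpose[OF t(1), of "i + 1"] marked_transpose[OF t(3), of i]
  show "three_strand_step c i \<circ> three_strand_step (c \<circ> transpose i (i + 1)) (i + 1) \<circ>
        three_strand_step (c \<circ> transpose i (i + 1) \<circ> transpose (i + 1) (i + 2)) i =
      three_strand_step c (i + 1) \<circ> three_strand_step (c \<circ> transpose (i + 1) (i + 2)) i \<circ>
        three_strand_step (c \<circ> transpose (i + 1) (i + 2) \<circ> transpose i (i + 1)) (i + 1)"
  proof -
    have i2: "i + 2 = i + 1 + 1" by simp
    have cases: "x < i \<or> x = i \<or> x = i + 1 \<or> x = i + 1 + 1 \<or> i + 1 + 1 < x" for x by linarith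
    show ?thesis
      unfolding i2 e tt[THEN three_strand_step_eq]
      using cases[of p] cases[of q] cases[of r] ne
      by (elim disjE; simp add: transpose_def fun_eq_iff)
  qed
qed

section \<open>Partitioned braid groups\<close>

lemma presented_group_inv_letter:
  assumes "x \<in> S"
  shows "inv\<^bsub>presented_group S R\<^esub> (pres_rel S R `` {[(x, True)]}) = pres_rel S R `` {[(x, False)]}"
proof -
  interpret group "presented_group S R" by (rule group_presented_group)
  have "pres_eq S R [(x, False), (x, True)] []"
    using pres_eq.cancel[of "[]" S "[]" x R False] assms by simp
  moreover have "pres_rel S R `` {[(x, b)]} \<in> carrier (presented_group S R)" for b
    unfolding presented_group_carrier using assms by (intro bexI[of _ "[(x, b)]"]) auto
  ultimately show ?thesis
    using assms by (intro inv_equality) (simp_all add: presented_group_mult presented_group_one pres_class_eq_iff)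
qed

lemma presented_group_generate:
  "carrier (presented_group S R) = generate (presented_group S R) ((\<lambda>x. pres_rel S R `` {[(x, True)]}) ` S)"
    (is "_ = generate ?G ?X")
proof -
  interpret group ?G by (rule group_presented_group)
  have "pres_rel S R `` {w} \<in> generate ?G ?X" if "w \<in> words S" for w
    using that
  proof (induction w)
    case Nil
    then show ?case using generate.one[of ?G ?X] by (simp add: presented_group_one)
  next
    case (Cons a w)
    obtain x b where a: "a = (x, b)" by force
    have x: "x \<in> S" "w \<in> words S" using Cons.prems by (auto simp: a)
    have "pres_rel S R `` {[(x, b)]} \<in> generate ?G ?X"
    proof (cases b)
      case True
      then show ?thesis using x by (auto intro: generate.incl)
    next
      case False
      then show ?thesis
        using x presented_group_inv_letter[OF x(1), of R] generate.inv[of "pres_rel S R `` {[(x, True)]}" ?X ?G] by simp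
    qed
    then have "pres_rel S R `` {[(x, b)]} \<otimes>\<^bsub>?G\<^esub> pres_rel S R `` {w} \<in> generate ?G ?X"
      using Cons.IH[OF x(2)] by (rule generate.eng)
    then show ?case using x by (simp add: presented_group_mult a)
  qed
  moreover have "generate ?G ?X \<subseteq> carrier ?G"
    by (intro generate_incl) (auto simp: presented_group_carrier intro!: bexI[of _ "[(_, True)]"])
  ultimately show ?thesis by (auto simp: presented_group_carrier)
qed

definition braid_generator :: "nat \<Rightarrow> nat \<Rightarrow> nat letter list set" where
  "braid_generator n i = pres_rel {1..<n} (braid_relations n) `` {[(i, True)]}"

lemma artin_group_braid_group: "artin_group (braid_group n) n (braid_generator n) braid_perm"
proof -
  interpret group "braid_group n" by (rule group_braid_group)
  have mult: "pres_rel {1..<n} (braid_relations n) `` {u} \<otimes>\<^bsub>braid_group n\<^esub> pres_rel {1..<n} (braid_relations n) `` {v}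
      = pres_rel {1..<n} (braid_relations n) `` {u @ v}" if "u \<in> words {1..<n}" "v \<in> words {1..<n}" for u v
    unfolding braid_group_def using that by (rule presented_group_mult)
  have word: "[(i, True)] \<in> words {1..<n}" if "1 \<le> i" "i < n" for i using that by simp
  have rel: "pres_rel {1..<n} (braid_relations n) `` {r} = pres_rel {1..<n} (braid_relations n) `` {s}"
    if "(r, s) \<in> braid_relations n" "r \<in> words {1..<n}" "s \<in> words {1..<n}" for r s
    using pres_eq.rel[of "[]" "{1..<n}" "[]" r s "braid_relations n"] that by (simp add: pres_class_eq_iff)
  show ?thesis
  proof
    fix i assume i: "1 \<le> i" "i < n"
    then show "braid_generator n i \<in> carrier (braid_group n)"
      unfolding braid_generator_def braid_group_def presented_group_carrier using word by blast
    show "braid_perm (braid_generator n i) = transpose i (i + 1)"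
      unfolding braid_generator_def braid_perm_class[OF word[OF i]] by simp
  next
    fix i j assume ij: "1 \<le> i" "i + 2 \<le> j" "j < n"
    then have "([(i, True), (j, True)], [(j, True), (i, True)]) \<in> braid_relations n"
      unfolding braid_relations_def by blast
    from rel[OF this] show "braid_generator n i \<otimes>\<^bsub>braid_group n\<^esub> braid_generator n j =
        braid_generator n j \<otimes>\<^bsub>braid_group n\<^esub> braid_generator n i"
      unfolding braid_generator_def using ij by (simp add: mult del: One_nat_def)
  next
    fix i assume i: "1 \<le> i" "i + 1 < n"
    then have "([(i, True), (i + 1, True), (i, True)], [(i + 1, True), (i, True), (i + 1, True)])
        \<in> braid_relations n"
      unfolding braid_relations_def by blast
    from rel[OF this] show "braid_generator n i \<otimes>\<^bsub>braid_group n\<^esub> braid_generator n (i + 1) \<otimes>\<^bsub>braid_group n\<^esub> braid_generator n i =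
        braid_generator n (i + 1) \<otimes>\<^bsub>braid_group n\<^esub> braid_generator n i \<otimes>\<^bsub>braid_group n\<^esub> braid_generator n (i + 1)"
      unfolding braid_generator_def using i by (simp add: mult del: One_nat_def)
  next
    show "carrier (braid_group n) = generate (braid_group n) (braid_generator n ` {1..<n})"
      unfolding braid_generator_def[abs_def] braid_group_def by (rule presented_group_generate)
  next
    fix x y assume "x \<in> carrier (braid_group n)" "y \<in> carrier (braid_group n)"
    then show "braid_perm (x \<otimes>\<^bsub>braid_group n\<^esub> y) = braid_perm x \<circ> braid_perm y"
      using hom_mult[OF braid_perm_hom] by (auto simp: sym_group_def)
  next
    fix x assume "x \<in> carrier (braid_group n)"
    then show "braid_perm x permutes {1..n}"
      using hom_in_carrier[OF braid_perm_hom] by (auto simp: sym_group_def)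
  qed
qed

section \<open>Blocks as level sets of a colouring\<close>

definition block_colour :: "nat list \<Rightarrow> nat \<Rightarrow> nat" where
  "block_colour lam k = (LEAST j. k \<le> sum_list (take (j + 1) lam))"

lemma sum_list_take_mono: "i \<le> j \<Longrightarrow> sum_list (take i lam) \<le> sum_list (take j (lam :: nat list))"
  by (metis le_add1 min.absorb1 sum_list.append take_add take_take le_Suc_ex)

lemma sum_list_take_Suc:
  "j < length lam \<Longrightarrow> sum_list (take (j + 1) lam) = sum_list (take j lam) + (lam ! j :: nat)"
  by (simp add: take_Suc_conv_app_nth)

lemma card_partition_block: "j < length lam \<Longrightarrow> card (partition_block lam j) = lam ! j"
  using sum_list_take_Suc[of j lam] by (simp add: partition_block_def)

lemma partition_block_subset: "partition_block lam j \<subseteq> {1..sum_list lam}"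
  using sum_list_take_mono[of "j + 1" "length lam" lam] sum_list_take_mono[of "length lam" "j + 1" lam]
  by (cases "j + 1 \<le> length lam") (auto simp: partition_block_def)

lemma partition_block_iff:
  assumes "k \<in> {1..sum_list lam}"
  shows "k \<in> partition_block lam j \<longleftrightarrow> block_colour lam k = j"
proof -
  let ?P = "\<lambda>j. k \<le> sum_list (take (j + 1) lam)"
  have "?P (length lam)" using assms by simp
  then have upper: "?P (block_colour lam k)" unfolding block_colour_def by (rule LeastI)
  have lower: "sum_list (take (block_colour lam k) lam) < k"
  proof (cases "block_colour lam k")
    case (Suc l)
    then have "\<not> ?P l" unfolding block_colour_def by (metis lessI not_less_Least)
    then show ?thesis using Suc by simp
  qed (use assms in simp)
  show ?thesis
  proof
    assume "k \<in> partition_block lam j"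
    then have k: "sum_list (take j lam) < k" "?P j" by (auto simp: partition_block_def)
    have "\<not> ?P i" if "i < j" for i using sum_list_take_mono[of "i + 1" j lam] that k by auto
    then show "block_colour lam k = j"
      unfolding block_colour_def using k(2) by (intro Least_equality) (auto simp: not_less[symmetric])
  next
    assume "block_colour lam k = j"
    then show "k \<in> partition_block lam j" using upper lower by (auto simp: partition_block_def)
  qed
qed

lemma block_colour_less:
  assumes "k \<in> {1..sum_list lam}"
  shows "block_colour lam k < length lam"
proof -
  have "k \<in> partition_block lam (block_colour lam k)" using partition_block_iff assms by blast
  then have "sum_list (take (block_colour lam k) lam) < sum_list lam"
    using assms by (auto simp: partition_block_def)
  then show ?thesis by (metis leI take_all less_irrefl)
qed

lemma block_colour_mono:
  assumes "1 \<le> i" "i < sum_list lam"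
  shows "block_colour lam i \<le> block_colour lam (i + 1)"
proof -
  have "i + 1 \<in> partition_block lam (block_colour lam (i + 1))"
    using partition_block_iff[of "i + 1" lam] assms by simp
  then show ?thesis
    unfolding block_colour_def[of lam i] by (intro Least_le) (auto simp: partition_block_def)
qed

text \<open>This makes the Young subgroup the stabiliser of one function. A permutation mapping each
  block into itself maps it onto itself by finiteness, and positions outside the range are fixed,
  hence keep their colour.\<close>

lemma young_subgroup_iff:
  "p \<in> young_subgroup lam \<longleftrightarrow> p permutes {1..sum_list lam} \<and> block_colour lam \<circ> p = block_colour lam"
proof (intro iffI conjI)
  assume p: "p \<in> young_subgroup lam"
  then show perm: "p permutes {1..sum_list lam}" by (simp add: young_subgroup_def sym_group_def)
  show "block_colour lam \<circ> p = block_colour lam"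
  proof
    fix k
    show "(block_colour lam \<circ> p) k = block_colour lam k"
    proof (cases "k \<in> {1..sum_list lam}")
      case True
      then have "p k \<in> partition_block lam (block_colour lam k)"
        using p block_colour_less[OF True] partition_block_iff[OF True] unfolding young_subgroup_def by blast
      then show ?thesis
        using partition_block_iff[of "p k" lam] True perm permutes_in_image by fastforce
    next
      case False
      then show ?thesis using perm by (simp add: permutes_not_in)
    qed
  qed
next
  assume p: "p permutes {1..sum_list lam} \<and> block_colour lam \<circ> p = block_colour lam"
  have "p ` partition_block lam j = partition_block lam j" for j
  proof (rule card_subset_eq)
    show "finite (partition_block lam j)" by (simp add: partition_block_def)
    show "p ` partition_block lam j \<subseteq> partition_block lam j"
    proof
      fix y assume "y \<in> p ` partition_block lam j"
      then obtain k where k: "k \<in> partition_block lam j" "y = p k" by blast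
      then have "k \<in> {1..sum_list lam}" using partition_block_subset by blast
      moreover have "p k \<in> {1..sum_list lam}" using p calculation permutes_in_image[of p "{1..sum_list lam}" k] by blast
      moreover have "block_colour lam (p k) = block_colour lam k" using p by (metis comp_apply)
      ultimately show "y \<in> partition_block lam j"
        using k partition_block_iff[of k lam j] partition_block_iff[of "p k" lam j] by simp
    qed
    show "card (p ` partition_block lam j) = card (partition_block lam j)"
      using p by (intro card_image permutes_inj_on[of p "{1..sum_list lam}"]) simp
  qed
  then show "p \<in> young_subgroup lam" using p by (simp add: young_subgroup_def sym_group_def)
qed

lemma coloured_braids_block_colour:
  "coloured_braids (braid_group (sum_list lam)) (sum_list lam) (braid_generator (sum_list lam)) braid_perm
    (block_colour lam)"
  unfolding coloured_braids_def coloured_braids_axioms_def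
  using artin_group_braid_group block_colour_mono by blast

lemma other_in_block:
  assumes "finite F" "card F < lam ! j" "j < length lam"
  shows "\<exists>w \<in> {1..sum_list lam}. w \<notin> F \<and> block_colour lam w = j"
proof -
  have "\<not> partition_block lam j \<subseteq> F"
    using card_mono[OF assms(1), of "partition_block lam j"] card_partition_block[OF assms(3)] assms(2) by auto
  then show ?thesis using partition_block_subset partition_block_iff by blast
qed

lemma block_size_pos: "partition_of n lam \<Longrightarrow> j < length lam \<Longrightarrow> 1 \<le> lam ! j"
  by (simp add: partition_of_def)

lemma partitioned_lower_central_2_eq_3:
  assumes "partition_of n lam" "blocks_large_save_two lam"
  shows "lower_central (partitioned_braid_group lam) 2 = lower_central (partitioned_braid_group lam) 3"
proof -
  let ?n = "sum_list lam"
  interpret coloured_braids "braid_group ?n" ?n "braid_generator ?n" braid_perm "block_colour lam"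
    by (rule coloured_braids_block_colour)
  have "colour_group = {X \<in> carrier (braid_group ?n). braid_perm X \<in> young_subgroup lam}"
    unfolding colour_group_def young_subgroup_iff using perm_permutes by blast
  then have L: "partitioned_braid_group lam = L" by (simp add: partitioned_braid_group_def)
  let ?c = "block_colour lam"
  have sizes: "lam ! ?c u \<ge> 3 \<or> lam ! ?c u = 1" if "u \<in> {1..?n}" for u
    using assms(2) block_colour_less[OF that] by (simp add: blocks_large_save_two_def)
  have single: "lam ! ?c u = 1" if "u \<in> {1..?n}" "\<not> multiple u" for u
    using other_in_block[of "{u}" lam "?c u"] sizes[OF that(1)] block_colour_less[OF that(1)] that(2)
    unfolding multiple_def by fastforce
  show ?thesis
    unfolding L
  proof (rule lower_central_2_eq_3)
    fix u v assume uv: "u \<in> {1..?n}" "v \<in> {1..?n}" "u \<noteq> v" "?c u = ?c v"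
    \<comment> \<open>Two strands rule out block size 1, so the block has at least three.\<close>
    have "{u, v} \<subseteq> partition_block lam (?c u)" using uv partition_block_iff by auto
    then have "card {u, v} \<le> lam ! ?c u"
      using card_partition_block[OF block_colour_less[OF uv(1)]] card_mono[of "partition_block lam (?c u)" "{u, v}"]
      by (simp add: partition_block_def)
    then have "3 \<le> lam ! ?c u" using sizes[OF uv(1)] uv(3) by auto
    then show "\<exists>w \<in> {1..?n}. w \<noteq> u \<and> w \<noteq> v \<and> ?c w = ?c u"
      using other_in_block[of "{u, v}" lam "?c u"] block_colour_less[OF uv(1)] uv(3) by auto
  next
    fix u v w assume uvw: "u \<in> {1..?n}" "v \<in> {1..?n}" "w \<in> {1..?n}"
      "?c u \<noteq> ?c v" "?c u \<noteq> ?c w" "?c v \<noteq> ?c w"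
    show "multiple u \<or> multiple v \<or> multiple w"
    proof (rule ccontr)
      assume "\<not> ?thesis"
      then have "{?c u, ?c v, ?c w} \<subseteq> {i. i < length lam \<and> lam ! i = 1}"
        using single uvw block_colour_less by auto
      then have "card {?c u, ?c v, ?c w} \<le> card {i. i < length lam \<and> lam ! i = 1}"
        by (intro card_mono) auto
      then show False using assms(2) uvw by (simp add: blocks_large_save_two_def)
    qed
  qed
qed


section \<open>Exponent sum and the groups on one and two strands\<close>

lemma (in group) lower_central_1_neq_2:
  assumes "f \<in> hom G integer_group" "x \<in> carrier G" "f x \<noteq> 0"
  shows "lower_central G 1 \<noteq> lower_central G 2"
proof -
  interpret f: group_hom G integer_group f
    using assms(1) by (auto simp: group_hom_def group_hom_axioms_def is_group)
  have "lower_central G 2 \<subseteq> kernel G integer_group f"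
    unfolding numeral_2_eq_2 lower_central.simps commutator_subgroup_def
    by (intro generate_subgroup_incl f.subgroup_kernel) (auto simp: kernel_def f.hom_inv)
  then show ?thesis using assms(2,3) by (auto simp: kernel_def)
qed

text \<open>With the constant step the value of a word is the translation by its exponent sum; the
  cocycle construction supplies the invariance under the relations.\<close>

interpretation exponent_sum: braid_cocycle "\<lambda>c i k. k + 1" UNIV
proof
  show "affine (\<lambda>k. k + 1)" by (intro exI[of _ 1]) auto
qed auto

definition exponent_sum :: "nat letter list set \<Rightarrow> int" where
  "exponent_sum X = exponent_sum.class_val (\<lambda>_. 0) X 0"

lemma exponent_sum_val: "exponent_sum.val c w k = k + exponent_sum.val (\<lambda>_. 0) w 0"
proof (induction w arbitrary: c k)
  case (Cons a w)
  obtain i b where a: "a = (i, b)" by force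
  have shift: "inv' (\<lambda>k::int. k + 1) = (\<lambda>k. k - 1)" by (rule inv_unique_comp) auto
  note IH = Cons[of "c \<circ> transpose i (i + 1)" k] Cons[of "(\<lambda>_. 0) \<circ> transpose i (i + 1)" 0]
  show ?case unfolding a exponent_sum.val.simps comp_apply IH shift by simp
qed simp

lemma exponent_sum_class:
  "w \<in> words {1..<n} \<Longrightarrow>
    exponent_sum (pres_rel {1..<n} (braid_relations n) `` {w}) = exponent_sum.val (\<lambda>_. 0) w 0"
  by (simp add: exponent_sum_def exponent_sum.class_val_class del: One_nat_def)

lemma exponent_sum_hom: "exponent_sum \<in> hom (braid_group n) integer_group"
proof (rule homI)
  fix X Y assume "X \<in> carrier (braid_group n)" "Y \<in> carrier (braid_group n)"
  then obtain u v where u: "u \<in> words {1..<n}" "X = pres_rel {1..<n} (braid_relations n) `` {u}"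
    and v: "v \<in> words {1..<n}" "Y = pres_rel {1..<n} (braid_relations n) `` {v}"
    unfolding braid_group_def presented_group_carrier by blast
  have "X \<otimes>\<^bsub>braid_group n\<^esub> Y = pres_rel {1..<n} (braid_relations n) `` {u @ v}"
    unfolding braid_group_def u(2) v(2) using u(1) v(1) by (rule presented_group_mult)
  moreover have "exponent_sum.val (\<lambda>_. 0) (u @ v) 0 = exponent_sum.val (\<lambda>_. 0) u 0 + exponent_sum.val (\<lambda>_. 0) v 0"
    using exponent_sum_val[of "\<lambda>_. 0" u "exponent_sum.val ((\<lambda>_. 0) \<circ> word_perm u) v 0"]
      exponent_sum_val[of "(\<lambda>_. 0) \<circ> word_perm u" v 0]
    by (simp add: exponent_sum.val_append)
  ultimately show "exponent_sum (X \<otimes>\<^bsub>braid_group n\<^esub> Y) = exponent_sum X \<otimes>\<^bsub>integer_group\<^esub> exponent_sum Y"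
    using u v by (simp add: exponent_sum_class del: One_nat_def)
qed simp

lemma class_in_partitioned_braid_group:
  assumes "w \<in> words {1..<sum_list lam}" "word_perm w \<in> young_subgroup lam"
  shows "pres_rel {1..<sum_list lam} (braid_relations (sum_list lam)) `` {w} \<in> carrier (partitioned_braid_group lam)"
  using assms unfolding partitioned_braid_group_def braid_group_def
  by (auto simp: presented_group_carrier braid_perm_class simp del: One_nat_def)

lemma id_in_young_subgroup: "id \<in> young_subgroup lam"
  by (simp only: young_subgroup_iff permutes_id comp_id simp_thms)

lemma partitioned_lower_central_1_neq_2:
  assumes "2 \<le> sum_list lam"
  shows "lower_central (partitioned_braid_group lam) 1 \<noteq> lower_central (partitioned_braid_group lam) 2"
proof -
  \<comment> \<open>The square of the first generator is pure, so it lies in the group for every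
    partition; its exponent sum is 2.\<close>
  let ?n = "sum_list lam" and ?w = "[(1, True), (1, True)] :: nat letter list"
  interpret group "partitioned_braid_group lam" by (rule group_partitioned_braid_group)
  have w: "?w \<in> words {1..<?n}" using assms by simp
  have "word_perm ?w = id" by simp
  then have "word_perm ?w \<in> young_subgroup lam" by (simp only: id_in_young_subgroup)
  note x = class_in_partitioned_braid_group[OF w this]
  moreover have "exponent_sum (pres_rel {1..<?n} (braid_relations ?n) `` {?w}) \<noteq> 0"
    unfolding exponent_sum_class[OF w] by simp
  moreover have "exponent_sum \<in> hom (partitioned_braid_group lam) integer_group"
    using exponent_sum_hom[of ?n] by (auto simp: hom_def partitioned_braid_group_def)
  ultimately show ?thesis by (intro lower_central_1_neq_2)
qed

lemma braid_group_2_powers: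
  "carrier (braid_group 2) = {braid_generator 2 1 [^]\<^bsub>braid_group 2\<^esub> (k::int) | k. True}"
proof -
  interpret artin_group "braid_group 2" 2 "braid_generator 2" braid_perm by (rule artin_group_braid_group)
  have "{1..<2::nat} = {1}" by auto
  then have "carrier (braid_group 2) = generate (braid_group 2) {braid_generator 2 1}" using gen by simp
  then show ?thesis using generate_pow[of "braid_generator 2 1"] sig_closed[of 1] by auto
qed

lemma braid_group_2_iso: "braid_group 2 \<cong> integer_group"
proof -
  interpret artin_group "braid_group 2" 2 "braid_generator 2" braid_perm by (rule artin_group_braid_group)
  interpret e: group_hom "braid_group 2" integer_group exponent_sum
    using exponent_sum_hom by (auto simp: group_hom_def group_hom_axioms_def is_group)
  let ?g = "braid_generator 2 1"
  have g: "?g \<in> carrier (braid_group 2)" using sig_closed[of 1] by simp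
  have "exponent_sum ?g = 1"
    unfolding braid_generator_def using exponent_sum_class[of "[(1, True)]" 2] by simp
  then have pow: "exponent_sum (?g [^]\<^bsub>braid_group 2\<^esub> k) = k" for k :: int
  proof -
    have nat: "exponent_sum (?g [^]\<^bsub>braid_group 2\<^esub> m) = int m" for m :: nat
      using g \<open>exponent_sum ?g = 1\<close> by (induction m) auto
    show ?thesis
    proof (cases k rule: int_cases2)
      case (nonneg m)
      then show ?thesis using nat by (simp only: int_pow_int)
    next
      case (nonpos m)
      have "?g [^]\<^bsub>braid_group 2\<^esub> m \<in> carrier (braid_group 2)" using g by (rule nat_pow_closed)
      then show ?thesis unfolding nonpos int_pow_neg_int[OF g] using nat[of m] by simp
    qed
  qed
  have "exponent_sum \<in> iso (braid_group 2) integer_group"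
    unfolding iso_def bij_betw_def
  proof (intro CollectI conjI exponent_sum_hom)
    show "inj_on exponent_sum (carrier (braid_group 2))"
      unfolding braid_group_2_powers by (auto simp: inj_on_def pow simp del: One_nat_def)
    show "exponent_sum ` carrier (braid_group 2) = carrier integer_group"
      unfolding braid_group_2_powers using pow by (auto simp del: One_nat_def intro!: image_eqI)
  qed
  then show ?thesis by (auto simp: is_iso_def)
qed

lemma braid_group_2_commute:
  assumes "x \<in> carrier (braid_group 2)" "y \<in> carrier (braid_group 2)"
  shows "x \<otimes>\<^bsub>braid_group 2\<^esub> y = y \<otimes>\<^bsub>braid_group 2\<^esub> x"
proof -
  interpret artin_group "braid_group 2" 2 "braid_generator 2" braid_perm by (rule artin_group_braid_group)
  have g: "braid_generator 2 1 \<in> carrier (braid_group 2)" using sig_closed[of 1] by simp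
  show ?thesis
    using assms unfolding braid_group_2_powers
    by (auto simp: int_pow_mult[OF g, symmetric] add.commute simp del: One_nat_def)
qed

lemma lcs_stops_2: "lcs_stops (partitioned_braid_group [2])"
proof -
  interpret group "partitioned_braid_group [2]" by (rule group_partitioned_braid_group)
  have "x \<otimes>\<^bsub>partitioned_braid_group [2]\<^esub> y = y \<otimes>\<^bsub>partitioned_braid_group [2]\<^esub> x"
    if "x \<in> carrier (partitioned_braid_group [2])" "y \<in> carrier (partitioned_braid_group [2])" for x y
    using that braid_group_2_commute by (simp add: partitioned_braid_group_def)
  then have "lower_central (partitioned_braid_group [2]) 2 = lower_central (partitioned_braid_group [2]) (2 + 1)"
    using comm_group_lower_central[of 2] comm_group_lower_central[of "2 + 1"] by simp
  then show ?thesis unfolding lcs_stops_def by (intro exI[of _ 2]) simp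
qed

text \<open>The group on one strand is trivial, so its series is already constant from the first
  term: the degenerate member of the stable family.\<close>

lemma lcs_stops_at_1: "lcs_stops_at (partitioned_braid_group [1]) 1"
proof -
  let ?G = "partitioned_braid_group [1]"
  interpret group ?G by (rule group_partitioned_braid_group)
  have "X = pres_rel {1..<1} (braid_relations 1) `` {[]}" if "X \<in> carrier ?G" for X
    using that by (auto simp: partitioned_braid_group_def braid_group_def presented_group_carrier words_def)
  then have one: "X = \<one>\<^bsub>?G\<^esub>" if "X \<in> carrier ?G" for X using that one_closed by metis
  then have "carrier ?G = {\<one>\<^bsub>?G\<^esub>}" using one_closed by blast
  moreover have "lower_central ?G 2 = {\<one>\<^bsub>?G\<^esub>}"
  proof (rule comm_group_lower_central)
    show "x \<otimes>\<^bsub>?G\<^esub> y = y \<otimes>\<^bsub>?G\<^esub> x" if "x \<in> carrier ?G" "y \<in> carrier ?G" for x y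
      using one[OF that(1)] one[OF that(2)] by simp
  qed simp
  ultimately show ?thesis by (auto simp: lcs_stops_at_def numeral_2_eq_2)
qed


section \<open>Partitions for which the series does not stop\<close>

lemma (in braid_cocycle) val_conjugate:
  assumes "c \<in> V" "d \<in> words {1..<n}"
  defines "d' \<equiv> rev (map (\<lambda>(x, b). (x, \<not> b)) d)"
  obtains e a where "e = 1 \<or> e = -1"
    "\<And>m f b. word_perm m = id \<Longrightarrow> val (c \<circ> word_perm d) m = (\<lambda>k. f * k + b) \<Longrightarrow>
      val c (d @ m @ d') = (\<lambda>k. f * k + (e * b + a - f * a))"
    "\<And>m. word_perm m = id \<Longrightarrow> word_perm (d @ m @ d') = id"
    "d' \<in> words {1..<n}"
proof -
  have "rev (map (\<lambda>(x, b). (x, \<not> b)) w) \<in> words S" if "w \<in> words S" for w :: "nat letter list" and S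
    using that by (auto simp: words_def)
  then have d': "d' \<in> words {1..<n}" using assms(2) by (simp only: d'_def)
  have "rev (map (\<lambda>(x, b). (x, \<not> b)) d') = d"
    by (simp add: d'_def rev_map comp_def case_prod_beta)
  then have eq: "pres_eq {1..<n} (braid_relations n) (d @ d') []"
    using pres_eq_inverse[OF d', of "braid_relations n"] by simp
  obtain e a where ea: "e = 1 \<or> e = -1" "val c d = (\<lambda>k. e * k + a)" using val_affine[OF assms(1)] by blast
  have "val c d \<circ> val (c \<circ> word_perm d) d' = id"
    using val_pres_eq[OF eq assms(1)] by (simp add: val_append)
  then have inv: "e * val (c \<circ> word_perm d) d' k + a = k" for k
    unfolding ea(2) by (simp add: fun_eq_iff)
  have d'_val: "val (c \<circ> word_perm d) d' = (\<lambda>k. e * (k - a))"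
  proof
    show "val (c \<circ> word_perm d) d' k = e * (k - a)" for k using inv[of k] ea(1) by auto
  qed
  \<comment> \<open>Conjugation of an affine map by \<open>e * k + a\<close> with
    \<open>e = 1\<close> or \<open>e = -1\<close> preserves its slope \<open>f\<close>; reflections
    and nontrivial translations keep their kind.\<close>
  have "val c (d @ m @ d') = (\<lambda>k. f * k + (e * b + a - f * a))"
    if "word_perm m = id" "val (c \<circ> word_perm d) m = (\<lambda>k. f * k + b)" for m f b
    unfolding val_append that comp_id d'_val ea(2) using ea(1) by (auto simp: fun_eq_iff algebra_simps)
  moreover have "word_perm (d @ m @ d') = id" if "word_perm m = id" for m
    using word_perm_cong[OF eq] unfolding word_perm_append that by simp
  ultimately show ?thesis using that ea(1) d' by blast
qed

lemma transpose_in_young_subgroup: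
  assumes "a \<in> {1..sum_list lam}" "b \<in> {1..sum_list lam}" "block_colour lam a = block_colour lam b"
  shows "transpose a b \<in> young_subgroup lam"
  unfolding young_subgroup_iff
  using assms permutes_swap_id[of a "{1..sum_list lam}" b] by (auto simp: fun_eq_iff transpose_def)

lemma not_lcs_stops_block_2:
  assumes lam: "partition_of n lam" "j < length lam" "lam ! j = 2" "lam \<noteq> [2]"
  shows "\<not> lcs_stops (partitioned_braid_group lam)"
proof -
  define a where "a = sum_list (take j lam) + 1"
  let ?n = "sum_list lam"
  have block: "partition_block lam j = {a, a + 1}"
    using sum_list_take_Suc[OF lam(2)] lam(3) by (auto simp: partition_block_def a_def)
  have a: "1 \<le> a" "a + 1 \<le> ?n" using partition_block_subset[of lam j] unfolding block by auto
  have col: "block_colour lam a = j" "block_colour lam (a + 1) = j"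
    using partition_block_iff[of a lam j] partition_block_iff[of "a + 1" lam j] a unfolding block by auto
  \<comment> \<open>As the partition is not \<open>[2]\<close>, another nonempty block exists, so
    the block of size 2 has a neighbouring position.\<close>
  have more: "a + 1 < ?n \<or> 1 < a"
  proof (rule ccontr)
    assume "\<not> ?thesis"
    then have all: "{1..?n} = {a, a + 1}" using a by auto
    have "length lam \<noteq> 1" using lam(2-4) by (cases lam) auto
    then obtain i where i: "i < length lam" "i \<noteq> j"
      using lam(2) by (metis One_nat_def less_one linorder_neqE_nat not_less_zero Suc_lessI length_greater_0_conv zero_less_Suc)
    then have "0 < lam ! i" using block_size_pos[OF lam(1)] by fastforce
    then obtain w where "w \<in> {1..?n}" "block_colour lam w = i"
      using other_in_block[of "{}" lam i] i by auto
    then show False using col i(2) unfolding all by auto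
  qed
  define c where "c = (\<lambda>k. if k = a \<or> k = a + 1 then 1 else 0 :: nat)"
  have reds: "reds c a (a + 1)" by (simp add: reds_def c_def)
  have c: "c \<circ> p = c" if "p \<in> young_subgroup lam" for p
  proof -
    have "p ` {a, a + 1} = {a, a + 1}" using that lam(2) unfolding young_subgroup_def block[symmetric] by blast
    moreover have "inj p" using that permutes_inj unfolding young_subgroup_iff by blast
    ultimately have "p k \<in> {a, a + 1} \<longleftrightarrow> k \<in> {a, a + 1}" for k by (metis inj_image_mem_iff)
    then show ?thesis by (auto simp: c_def fun_eq_iff)
  qed
  have swap: "transpose a (a + 1) \<in> young_subgroup lam"
    using a col by (intro transpose_in_young_subgroup) auto
  \<comment> \<open>The full twist at \<open>b\<close> links one strand of the block with the strand
    next to the block. It provides the translation; the swap inside the block provides the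
    reflection.\<close>
  define b where "b = (if a + 1 < ?n then a + 1 else a - 1)"
  have b: "1 \<le> b" "b < ?n" "b = a + 1 \<or> (b + 1 = a)" using a more by (auto simp: b_def)
  let ?t = "[(b, True), (b, True)]"
  note e = two_red_step_eq[OF reds, of b] two_red_step_eq[OF reds_transpose[OF reds, of b], of b]
  \<comment> \<open>Both crossings involve the same red strand: the second one on the right side of
    the block, the first one on the left side.\<close>
  have t: "two_red.val c ?t = (\<lambda>k. k + (if b = a + 1 then -2 else 2))"
    using b(3)
  proof
    assume h: "b = a + 1"
    show ?thesis unfolding two_red.val.simps e unfolding h by (simp add: fun_eq_iff transpose_def)
  next
    assume "b + 1 = a"
    then have h: "a = b + 1" by simp
    show ?thesis unfolding two_red.val.simps e unfolding h by (simp add: fun_eq_iff transpose_def)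
  qed
  have s: "two_red.val c [(a, True)] = (\<lambda>k. - k + 0)"
    unfolding two_red.val.simps two_red_step_eq[OF reds] by (simp add: fun_eq_iff)
  show ?thesis
  proof (rule two_red.not_lcs_stops_cocycle[OF _ c _ _ s _ _ t])
    show "c \<in> {c. \<exists>a b. reds c a b}" using reds by blast
    show "[(a, True)] \<in> words {1..<?n}" "?t \<in> words {1..<?n}" using a b by auto
    show "word_perm [(a, True)] \<in> young_subgroup lam" using swap by simp
    have "word_perm ?t = id" by (simp add: fun_eq_iff)
    then show "word_perm ?t \<in> young_subgroup lam" by (simp only: id_in_young_subgroup)
  qed auto
qed

text \<open>The three strands need not be adjacent. A braid \<open>d\<close> relates their positions
  to 1, 2, 3, where the values are computed; conjugation by \<open>d\<close> carries the result back
  to \<open>c\<close>.\<close>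

lemma not_lcs_stops_three_singletons:
  assumes j: "j1 < length lam" "j2 < length lam" "j3 < length lam" "distinct [j1, j2, j3]"
    and "lam ! j1 = 1" "lam ! j2 = 1" "lam ! j3 = 1"
  shows "\<not> lcs_stops (partitioned_braid_group lam)"
proof -
  let ?n = "sum_list lam"
  define pos where "pos j = sum_list (take j lam) + 1" for j
  have block: "partition_block lam j = {pos j}" if "j < length lam" "lam ! j = 1" for j
    using sum_list_take_Suc[OF that(1)] that(2) by (auto simp: partition_block_def pos_def)
  have pos: "pos j \<in> {1..?n}" "block_colour lam (pos j) = j" if "j < length lam" "lam ! j = 1" for j
    using block[OF that] partition_block_subset[of lam j] partition_block_iff[of "pos j" lam j] by auto
  have fixed: "p (pos j) = pos j" if "p \<in> young_subgroup lam" "j < length lam" "lam ! j = 1" for p j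
  proof -
    have "p ` {pos j} = {pos j}" using that block[OF that(2,3)] unfolding young_subgroup_def by force
    then show ?thesis by simp
  qed
  define c where "c k = (if k = pos j1 then 1 else if k = pos j2 then 2 else if k = pos j3 then 3 else 0 :: nat)" for k
  have dist: "distinct [pos j1, pos j2, pos j3]" using pos j assms(5-7) by (metis distinct_length_2_or_more distinct_singleton)
  have marked: "marked c (pos j1) (pos j2) (pos j3)" using dist by (auto simp: marked_def c_def)
  have inv: "c \<circ> p = c" if p: "p \<in> young_subgroup lam" for p
  proof -
    have "inj p" using p permutes_inj unfolding young_subgroup_iff by blast
    then have "p k = pos j \<longleftrightarrow> k = pos j" if "j < length lam" "lam ! j = 1" for j k
      using fixed[OF p that] by (metis injD)
    then show ?thesis using j assms(5-7) by (auto simp: c_def fun_eq_iff)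
  qed
  interpret artin_group "braid_group ?n" ?n "braid_generator ?n" braid_perm by (rule artin_group_braid_group)
  have sub: "set [pos j1, pos j2, pos j3] \<subseteq> {1..?n}" using pos j assms(5-7) by simp
  have "card (set [pos j1, pos j2, pos j3]) \<le> card {1..?n}" using sub by (intro card_mono) auto
  then have n: "3 \<le> ?n" using distinct_card[OF dist] by simp
  obtain X where X: "X \<in> carrier (braid_group ?n)"
    "\<And>k. k < length [pos j1, pos j2, pos j3] \<Longrightarrow> braid_perm X (Suc k) = [pos j1, pos j2, pos j3] ! k"
    using lift_prefix[OF dist sub] by blast
  then obtain d where d: "d \<in> words {1..<?n}" "X = pres_rel {1..<?n} (braid_relations ?n) `` {d}"
    unfolding braid_group_def presented_group_carrier by blast
  have wd: "word_perm d 1 = pos j1" "word_perm d 2 = pos j2" "word_perm d 3 = pos j3"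
    using X(2)[of 0] X(2)[of 1] X(2)[of 2] unfolding d(2) braid_perm_class[OF d(1)]
    by (simp_all add: numeral_2_eq_2 numeral_3_eq_3)
  have "inj (word_perm d)" using word_perm_permutes[OF d(1)] permutes_inj by blast
  then have "word_perm d k = pos j1 \<longleftrightarrow> k = 1" "word_perm d k = pos j2 \<longleftrightarrow> k = 2"
    "word_perm d k = pos j3 \<longleftrightarrow> k = 3" for k
    unfolding wd[symmetric] by (simp_all only: inj_eq)
  then have m: "marked (c \<circ> word_perm d) 1 2 3" unfolding marked_def c_def comp_apply by simp
  let ?c = "c \<circ> word_perm d" and ?A = "[(1, True), (1, True)]" and ?B = "[(2, True), (2, True)]"
  have A: "three_strand.val ?c ?A = (\<lambda>k. (-1) * k + 0)"
    unfolding three_strand.val.simps three_strand_step_eq[OF m]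
      three_strand_step_eq[OF marked_transpose[OF m, of 1]] by (simp add: fun_eq_iff transpose_def)
  have B: "three_strand.val ?c ?B = (\<lambda>k. 1 - k)"
    unfolding three_strand.val.simps three_strand_step_eq[OF m]
      three_strand_step_eq[OF marked_transpose[OF m, of 2]] by (simp add: fun_eq_iff transpose_def)
  have wA: "word_perm ?A = id" "word_perm ?B = id" by (simp_all add: fun_eq_iff)
  have wAB: "word_perm (?A @ ?B) = id" by (simp only: word_perm_append wA comp_id)
  \<comment> \<open>The two full twists give reflections with different centres, so their product is
    a nontrivial translation.\<close>
  have AB: "three_strand.val ?c (?A @ ?B) = (\<lambda>k. 1 * k + (-1))"
    unfolding three_strand.val_append A B wA comp_id by (simp add: fun_eq_iff)
  have cV: "c \<in> {c. \<exists>p q r. marked c p q r}" using marked by blast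
  define d' where "d' = rev (map (\<lambda>(x, b). (x, \<not> b)) d)"
  obtain e a where ea: "e = 1 \<or> e = -1"
    "\<And>m f b. word_perm m = id \<Longrightarrow> three_strand.val ?c m = (\<lambda>k. f * k + b) \<Longrightarrow>
      three_strand.val c (d @ m @ d') = (\<lambda>k. f * k + (e * b + a - f * a))"
    "\<And>m. word_perm m = id \<Longrightarrow> word_perm (d @ m @ d') = id"
    "d' \<in> words {1..<?n}"
    using three_strand.val_conjugate[OF cV d(1)] unfolding d'_def by blast
  have s: "three_strand.val c (d @ ?A @ d') = (\<lambda>k. - k + 2 * a)"
    unfolding ea(2)[OF wA(1) A] by simp
  have t: "three_strand.val c (d @ (?A @ ?B) @ d') = (\<lambda>k. k + (- e))"
    unfolding ea(2)[OF wAB AB] by simp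
  show ?thesis
  proof (rule three_strand.not_lcs_stops_cocycle[OF cV inv _ _ s _ _ t])
    show "d @ ?A @ d' \<in> words {1..<?n}" "d @ (?A @ ?B) @ d' \<in> words {1..<?n}"
      using d(1) ea(4) n by auto
    show "word_perm (d @ ?A @ d') \<in> young_subgroup lam" "word_perm (d @ (?A @ ?B) @ d') \<in> young_subgroup lam"
      unfolding ea(3)[OF wA(1)] ea(3)[OF wAB] by (rule id_in_young_subgroup)+
    show "- e \<noteq> 0" using ea(1) by auto
  qed
qed

theorem theorem3p6:
  fixes n :: nat and lam :: "nat list"
  assumes "n \<ge> 1" and "partition_of n lam"
  shows "(blocks_large_save_two lam \<and> lam \<noteq> [1] \<longrightarrow> lcs_stops_at (partitioned_braid_group lam) 2) \<and>
         (lam = [1] \<longrightarrow> lcs_stops_at (partitioned_braid_group lam) 1) \<and>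
         (\<not> blocks_large_save_two lam \<and> lam \<noteq> [2] \<longrightarrow> \<not> lcs_stops (partitioned_braid_group lam)) \<and>
         (lam = [2] \<longrightarrow> braid_group 2 \<cong> integer_group \<and> lcs_stops (partitioned_braid_group lam))"
proof (intro conjI impI)
  assume "blocks_large_save_two lam \<and> lam \<noteq> [1]"
  then have large: "blocks_large_save_two lam" and ne: "lam \<noteq> [1]" by auto
  have pos: "\<forall>k \<in> set lam. 1 \<le> k" "sum_list lam = n" using assms(2) by (auto simp: partition_of_def)
  have "2 \<le> sum_list lam"
  proof (cases lam)
    case (Cons x xs)
    then show ?thesis using pos ne by (cases xs) auto
  qed (use assms(1) pos in simp)
  note neq = partitioned_lower_central_1_neq_2[OF this]
  show "lcs_stops_at (partitioned_braid_group lam) 2"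
    unfolding lcs_stops_at_def
  proof (intro conjI allI impI)
    show "lower_central (partitioned_braid_group lam) 2 = lower_central (partitioned_braid_group lam) (2 + 1)"
      using partitioned_lower_central_2_eq_3[OF assms(2) large] by (simp only: numeral_plus_one semiring_norm)
    fix i :: nat assume "1 \<le> i \<and> i < 2"
    then have "i = 1" by simp
    then show "lower_central (partitioned_braid_group lam) i \<noteq> lower_central (partitioned_braid_group lam) (i + 1)"
      using neq by (simp only: one_add_one not_False_eq_True)
  qed simp
next
  assume "lam = [1]"
  then show "lcs_stops_at (partitioned_braid_group lam) 1" using lcs_stops_at_1 by simp
next
  assume "\<not> blocks_large_save_two lam \<and> lam \<noteq> [2]"
  then have not_large: "\<not> blocks_large_save_two lam" and ne: "lam \<noteq> [2]" by auto
  let ?S = "{i. i < length lam \<and> lam ! i = 1}"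
  \<comment> \<open>The size condition fails through a block that is neither 1 nor at least 3, hence
    2 as blocks are nonempty, or through too many blocks of size 1.\<close>
  consider i where "i < length lam" "lam ! i = 2" | "3 \<le> card ?S"
    using not_large block_size_pos[OF assms(2)] unfolding blocks_large_save_two_def
    by (metis One_nat_def Suc_1 Suc_leI le_neq_implies_less not_less_eq_eq numeral_3_eq_3)
  then show "\<not> lcs_stops (partitioned_braid_group lam)"
  proof cases
    case 1
    then show ?thesis using not_lcs_stops_block_2[OF assms(2)] ne by blast
  next
    case 2
    then obtain T where "T \<subseteq> ?S" "card T = 3" using obtain_subset_with_card_n by metis
    then obtain x y z where "x \<in> ?S" "y \<in> ?S" "z \<in> ?S" "distinct [x, y, z]"
      unfolding card_3_iff by auto
    then show ?thesis using not_lcs_stops_three_singletons[of x lam y z] by blast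
  qed
next
  assume "lam = [2]"
  then show "braid_group 2 \<cong> integer_group" "lcs_stops (partitioned_braid_group lam)"
    using braid_group_2_iso lcs_stops_2 by simp_all
qed

end
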